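(* Consider the quadrotor dynamics with the position tracking controller (thrust magnitude $f$ and moment vector $M$) described in the context. Suppose that the initial conditions satisfy $$1\le\Psi(R(0),R_c(0))<2,\qquad \|e_\Omega(0)\|^2<\frac{2}{\lambda_M(J)}\,k_R\,\bigl(2-\Psi(R(0),R_c(0))\bigr).$$ Then the zero equilibrium of the closed loop tracking errors $(e_x,e_v,e_R,e_\Omega)=(0,0,0,0)$ is exponentially attractive.
   Context: Definition (exponential attractiveness): an equilibrium point $z=0$ of a dynamic system is exponentially attractive if, for some $\delta>0$, there exist constants $\alpha(\delta)>0$ and $\beta>0$ such that $\|z(0)\|<\delta$ implies $\|z(t)\|\le\alpha(\delta)e^{-\beta t}$ for all $t>0$. (This differs from exponential stability, in which the bound is $\alpha(\delta)\|z(0)\|e^{-\beta t}$.) Notation: $\mathsf{SO(3)}=\{R\in\mathbb{R}^{3\times3}\mid R^TR=I,\ \det R=1\}$; $\mathsf{S}^2$ is the unit sphere in $\mathbb{R}^3$; $e_3=[0;0;1]$. The hat map $\hat{\cdot}:\mathbb{R}^3\to\mathfrak{so}(3)$ is defined by $\hat xy=x\times y$ for all $x,y\in\mathbb{R}^3$; the vee map $^\vee$ is its inverse. $\lambda_M(\cdot)$ denotes the maximum eigenvalue of a matrix. Quadrotor dynamics: with $x,v,\Omega\in\mathbb{R}^3$, $R\in\mathsf{SO(3)}$, mass $m>0$, gravitational acceleration $g>0$, and symmetric positive-definite inertia matrix $J\in\mathbb{R}^{3\times3}$, $$\dot x=v,\quad m\dot v=mge_3-fRe_3,\quad \dot R=R\hat\Omega,\quad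 J\dot\Omega+\Omega\times J\Omega=M,$$ where the controls are the thrust magnitude $f\in\mathbb{R}$ and the moment $M\in\mathbb{R}^3$. Position tracking controller: let $x_d(t)\in\mathbb{R}^3$ be a smooth position command, $e_x=x-x_d$, $e_v=v-\dot x_d$. For positive constants $k_x,k_v,k_R,k_\Omega$, $$f=(k_xe_x+k_ve_v+mge_3-m\ddot x_d)\cdot Re_3,$$ $$M=-k_Re_R-k_\Omega e_\Omega+\Omega\times J\Omega-J(\hat\Omega R^TR_c\Omega_c-R^TR_c\dot\Omega_c),$$ $$e_R=\tfrac12(R_c^TR-R^TR_c)^\vee,\qquad e_\Omega=\Omega-R^TR_c\Omega_c,$$ where $R_c=[b_{1_c};\,b_{3_c}\times b_{1_c};\,b_{3_c}]\in\mathsf{SO(3)}$ (the listed vectors are the columns), $\hat\Omega_c=R_c^T\dot R_c$, $$b_{3_c}=-\frac{-k_xe_x-k_ve_v-mge_3+m\ddot x_d}{\|-k_xe_x-k_ve_v-mge_3+m\ddot x_d\|}\in\mathsf{S}^2,$$ and $b_{1_c}\in\mathsf{S}^2$ is selected to be orthogonal to $b_{3_c}$ (so that $R_c$, $\Omega_c$, $\dot\Omega_c$ are well defined). The attitude error function is $\Psi(R,R_c)=\frac12\mathrm{tr}[I-R_c^TR]$. Standing assumptions: $\|-k_xe_x-k_ve_v-mge_3+m\ddot x_d\|\ne0$, and the commanded acceleration is uniformly bounded so that $\|-mge_3+m\ddot x_d\|<B$ for a given positive constant $B$.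
   Formalization: The constants α, β are uniform only over each compact set of initial data (Ψ(0), e_Ω(0)) satisfying the two inequalities, not over all such data at once, which fails as Ψ(0)→2; in exchange every radius δ>0 is allowed. *)

theory Defs
  imports "HOL-Analysis.Analysis"
begin

section \<open>Linear algebra on three-space\<close>

abbreviation e3 :: "real^3" where
  "e3 \<equiv> axis 3 1"

definition hat :: "real^3 \<Rightarrow> real^3^3" where
  "hat x = matrix (cross3 x)"

text \<open>The inverse of the injective map \<^const>\<open>hat\<close>; only meaningful on skew-symmetric matrices.\<close>

definition vee :: "real^3^3 \<Rightarrow> real^3" where
  "vee = inv hat"

lemma hat_mult_vector: "hat x *v y = cross3 x y"
proof -
  have "linear (cross3 x)"
    using bilinear_cross by (simp add: bilinear_def)
  then show ?thesis
    by (simp add: hat_def)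
qed

lemma inj_hat: "inj hat"
proof (rule injI)
  fix x y :: "real^3"
  assume "hat x = hat y"
  then have eq: "cross3 x z = cross3 y z" for z
    by (metis hat_mult_vector)
  show "x = y"
    using eq [of "axis 1 1"] eq [of "axis 2 1"]
    by (simp add: cross3_simps vec_eq_iff forall_3 axis_def)
qed

lemma vee_hat: "vee (hat x) = x"
  by (simp add: vee_def inj_hat)

text \<open>The set below is finite, and it is nonempty for symmetric matrices, so \<^const>\<open>Max\<close>
  is the largest eigenvalue.\<close>

definition max_eigenvalue :: "real^'n^'n \<Rightarrow> real" where
  "max_eigenvalue A = Max {c. \<exists>v. v \<noteq> 0 \<and> A *v v = c *\<^sub>R v}"

definition positive_definite :: "real^'n^'n \<Rightarrow> bool" where
  "positive_definite A \<longleftrightarrow> transpose A = A \<and> (\<forall>v. v \<noteq> 0 \<longrightarrow> v \<bullet> (A *v v) > 0)"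


section \<open>Time signals\<close>

text \<open>Signals live on the time axis \<open>t \<ge> 0\<close>; at \<open>t = 0\<close> derivatives are one-sided. Their
  values at negative times are irrelevant.\<close>

definition ddt :: "(real \<Rightarrow> 'a::real_normed_vector) \<Rightarrow> real \<Rightarrow> 'a" where
  "ddt f t = vector_derivative f (at t within {0..})"

definition smooth_signal :: "(real \<Rightarrow> 'a::real_normed_vector) \<Rightarrow> bool" where
  "smooth_signal f \<longleftrightarrow> (\<forall>n. (ddt ^^ n) f differentiable_on {0..})"

text \<open>Exponential attractiveness of the origin with radius \<open>\<delta>\<close> for the dynamic system whose
  trajectories are the members of \<open>Z\<close>. The constant \<open>\<alpha>\<close> may depend on \<open>\<delta>\<close>, but neither constant
  may depend on the trajectory. The radius is a parameter because the trajectories in \<open>Z\<close> may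
  start at a positive distance from the origin, where a small radius would make the condition
  vacuous.\<close>

definition exponentially_attractive ::
    "real \<Rightarrow> (real \<Rightarrow> 'a::real_normed_vector) set \<Rightarrow> bool" where
  "exponentially_attractive \<delta> Z \<longleftrightarrow>
     (\<exists>\<alpha>>0. \<exists>\<beta>>0. \<forall>z\<in>Z. norm (z 0) < \<delta> \<longrightarrow>
        (\<forall>t>0. norm (z t) \<le> \<alpha> * exp (- \<beta> * t)))"


section \<open>The quadrotor and its position tracking controller\<close>

record quadrotor =
  mass :: real
  grav :: real
  inertia :: "real^3^3"
  kx :: real
  kv :: real
  kR :: real
  kOmega :: real

definition admissible_quadrotor :: "quadrotor \<Rightarrow> bool" where
  "admissible_quadrotor q \<longleftrightarrow>
     mass q > 0 \<and> grav q > 0 \<and> positive_definite (inertia q) \<and>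
     kx q > 0 \<and> kv q > 0 \<and> kR q > 0 \<and> kOmega q > 0"

text \<open>A motion comprises the state and the heading direction \<open>b1c\<close> that the controller selects
  along it. In the following, \<open>xd\<close> is the position command.\<close>

record motion =
  pos :: "real \<Rightarrow> real^3"
  vel :: "real \<Rightarrow> real^3"
  att :: "real \<Rightarrow> real^3^3"
  angvel :: "real \<Rightarrow> real^3"
  b1c :: "real \<Rightarrow> real^3"

definition e_x :: "(real \<Rightarrow> real^3) \<Rightarrow> motion \<Rightarrow> real \<Rightarrow> real^3" where
  "e_x xd s t = pos s t - xd t"

definition e_v :: "(real \<Rightarrow> real^3) \<Rightarrow> motion \<Rightarrow> real \<Rightarrow> real^3" where
  "e_v xd s t = vel s t - ddt xd t"

definition command_force :: "quadrotor \<Rightarrow> (real \<Rightarrow> real^3) \<Rightarrow> motion \<Rightarrow> real \<Rightarrow> real^3" where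
  "command_force q xd s t =
     - kx q *\<^sub>R e_x xd s t - kv q *\<^sub>R e_v xd s t - (mass q * grav q) *\<^sub>R e3
     + mass q *\<^sub>R ddt (ddt xd) t"

definition b3c :: "quadrotor \<Rightarrow> (real \<Rightarrow> real^3) \<Rightarrow> motion \<Rightarrow> real \<Rightarrow> real^3" where
  "b3c q xd s t = - (command_force q xd s t /\<^sub>R norm (command_force q xd s t))"

text \<open>The three vectors are the columns, hence the transposition.\<close>

definition R_c :: "quadrotor \<Rightarrow> (real \<Rightarrow> real^3) \<Rightarrow> motion \<Rightarrow> real \<Rightarrow> real^3^3" where
  "R_c q xd s t =
     transpose (vector [b1c s t, cross3 (b3c q xd s t) (b1c s t), b3c q xd s t])"

definition Omega_c :: "quadrotor \<Rightarrow> (real \<Rightarrow> real^3) \<Rightarrow> motion \<Rightarrow> real \<Rightarrow> real^3" where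
  "Omega_c q xd s t = vee (transpose (R_c q xd s t) ** ddt (R_c q xd s) t)"

definition Psi :: "quadrotor \<Rightarrow> (real \<Rightarrow> real^3) \<Rightarrow> motion \<Rightarrow> real \<Rightarrow> real" where
  "Psi q xd s t = 1/2 * trace (mat 1 - transpose (R_c q xd s t) ** att s t)"

definition e_R :: "quadrotor \<Rightarrow> (real \<Rightarrow> real^3) \<Rightarrow> motion \<Rightarrow> real \<Rightarrow> real^3" where
  "e_R q xd s t =
     (1/2) *\<^sub>R vee (transpose (R_c q xd s t) ** att s t - transpose (att s t) ** R_c q xd s t)"

definition e_Omega :: "quadrotor \<Rightarrow> (real \<Rightarrow> real^3) \<Rightarrow> motion \<Rightarrow> real \<Rightarrow> real^3" where
  "e_Omega q xd s t =
     angvel s t - (transpose (att s t) ** R_c q xd s t) *v Omega_c q xd s t"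

definition thrust :: "quadrotor \<Rightarrow> (real \<Rightarrow> real^3) \<Rightarrow> motion \<Rightarrow> real \<Rightarrow> real" where
  "thrust q xd s t =
     (kx q *\<^sub>R e_x xd s t + kv q *\<^sub>R e_v xd s t + (mass q * grav q) *\<^sub>R e3
      - mass q *\<^sub>R ddt (ddt xd) t) \<bullet> (att s t *v e3)"

definition moment :: "quadrotor \<Rightarrow> (real \<Rightarrow> real^3) \<Rightarrow> motion \<Rightarrow> real \<Rightarrow> real^3" where
  "moment q xd s t =
     - kR q *\<^sub>R e_R q xd s t - kOmega q *\<^sub>R e_Omega q xd s t
     + cross3 (angvel s t) (inertia q *v angvel s t)
     - inertia q *v
         ((hat (angvel s t) ** transpose (att s t) ** R_c q xd s t) *v Omega_c q xd s t
          - (transpose (att s t) ** R_c q xd s t) *v ddt (Omega_c q xd s) t)"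

text \<open>The differentiability of \<^const>\<open>R_c\<close> and \<^const>\<open>Omega_c\<close> expresses that \<open>b1c\<close> is selected
  such that the commanded attitude, angular velocity and angular acceleration are well defined.\<close>

definition closed_loop :: "quadrotor \<Rightarrow> (real \<Rightarrow> real^3) \<Rightarrow> motion \<Rightarrow> bool" where
  "closed_loop q xd s \<longleftrightarrow>
     pos s differentiable_on {0..} \<and> vel s differentiable_on {0..} \<and>
     att s differentiable_on {0..} \<and> angvel s differentiable_on {0..} \<and>
     R_c q xd s differentiable_on {0..} \<and> Omega_c q xd s differentiable_on {0..} \<and>
     (\<forall>t\<ge>0.
        command_force q xd s t \<noteq> 0 \<and>
        norm (b1c s t) = 1 \<and> b1c s t \<bullet> b3c q xd s t = 0 \<and>
        rotation_matrix (att s t) \<and>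
        ddt (pos s) t = vel s t \<and>
        mass q *\<^sub>R ddt (vel s) t =
          (mass q * grav q) *\<^sub>R e3 - thrust q xd s t *\<^sub>R (att s t *v e3) \<and>
        ddt (att s) t = att s t ** hat (angvel s t) \<and>
        inertia q *v ddt (angvel s) t + cross3 (angvel s t) (inertia q *v angvel s t) =
          moment q xd s t)"

definition tracking_error ::
    "quadrotor \<Rightarrow> (real \<Rightarrow> real^3) \<Rightarrow> motion \<Rightarrow> real \<Rightarrow> (real^3) \<times> (real^3) \<times> (real^3) \<times> (real^3)" where
  "tracking_error q xd s t = (e_x xd s t, e_v xd s t, e_R q xd s t, e_Omega q xd s t)"

end

theory Submission
  imports Defs
begin

text \<open>In the relative attitude \<open>E = R_c\<^sup>T R\<close> the rotational error dynamics are autonomous: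
  \<open>E' = E hat(e\<^sub>\<Omega>)\<close> and \<open>J e\<^sub>\<Omega>' = - k\<^sub>R e\<^sub>R - k\<^sub>\<Omega> e\<^sub>\<Omega>\<close>. The energy \<open>e\<^sub>\<Omega> \<bullet> J e\<^sub>\<Omega> / 2 + k\<^sub>R \<Psi>\<close>
  is nonincreasing and, by compactness of the initial data, starts uniformly below \<open>2 k\<^sub>R\<close>. Hence
  \<open>\<Psi>\<close> stays uniformly below \<open>2\<close>, and there \<open>|e\<^sub>R|\<^sup>2 = \<Psi> (2 - \<Psi>)\<close> dominates \<open>\<Psi>\<close>, so that the
  energy plus a small multiple of \<open>e\<^sub>R \<bullet> J e\<^sub>\<Omega>\<close> decays exponentially. The position error is a damped
  oscillator driven by a force of size at most \<open>2 |A| sqrt \<Psi>\<close>, where the commanded force \<open>A\<close> grows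
  at most linearly in \<open>e_x\<close> and \<open>e_v\<close>. Since \<open>sqrt \<Psi>\<close> is integrable in time, this perturbation cannot
  prevent exponential decay.\<close>

section \<open>Rotation matrices and the attitude error\<close>

lemma bounded_bilinear_matrix_matrix_mult:
  "bounded_bilinear ((**) :: real^'n^'m \<Rightarrow> real^'p^'n \<Rightarrow> real^'p^'m)"
  unfolding bilinear_conv_bounded_bilinear [symmetric] bilinear_def linear_iff
  by (simp add: matrix_matrix_mult_def vec_eq_iff sum.distrib sum_distrib_left algebra_simps)

lemma bounded_bilinear_matrix_vector_mult:
  "bounded_bilinear ((*v) :: real^'n^'m \<Rightarrow> real^'n \<Rightarrow> real^'m)"
  unfolding bilinear_conv_bounded_bilinear [symmetric] bilinear_def linear_iff
  by (simp add: matrix_vector_mult_def vec_eq_iff sum.distrib sum_distrib_left algebra_simps)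

lemma bounded_linear_transpose:
  "bounded_linear (transpose :: real^'n^'m \<Rightarrow> real^'m^'n)"
  unfolding linear_conv_bounded_linear [symmetric] linear_iff
  by (simp add: transpose_def vec_eq_iff)

lemma bounded_linear_trace: "bounded_linear (trace :: real^'n^'n \<Rightarrow> real)"
  unfolding linear_conv_bounded_linear [symmetric] linear_iff
  by (simp add: trace_def sum.distrib sum_distrib_left)

lemma inner_matrix_vector_transpose:
  fixes A :: "real^'n^'m"
  shows "x \<bullet> (A *v y) = (transpose A *v x) \<bullet> y"
  by (metis dot_lmul_matrix inner_commute transpose_transpose vector_transpose_matrix)

lemma hat_eq_vector:
  "hat x = vector [vector [0, - x$3, x$2], vector [x$3, 0, - x$1], vector [- x$2, x$1, 0]]"
  by (simp add: hat_def matrix_def cross3_def vec_eq_iff forall_3 axis_def)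

lemma transpose_hat: "transpose (hat x) = - hat x"
  by (simp add: hat_eq_vector transpose_def vec_eq_iff forall_3)

lemma hat_diff: "hat (x - y) = hat x - hat y"
  by (simp add: hat_eq_vector vec_eq_iff forall_3)

lemma skew_eq_hat:
  fixes A :: "real^3^3"
  assumes "transpose A = - A"
  shows "A = hat (vector [A$3$2, A$1$3, A$2$1])"
proof -
  have *: "A$j$i = - A$i$j" for i j
    using arg_cong [OF assms, of "\<lambda>B. B$i$j"] by (simp add: transpose_def)
  have "A$1$1 = 0" "A$2$2 = 0" "A$3$3 = 0"
    using * [of 1 1] * [of 2 2] * [of 3 3] by linarith+
  with * [of 1 2] * [of 3 1] * [of 2 3] show ?thesis
    by (simp add: hat_eq_vector vec_eq_iff forall_3)
qed

text \<open>\<open>vee\<close> is an \<open>inv\<close>, so it can be undone only on the range of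
  \<open>hat\<close>; skew symmetry is what puts \<open>A\<close> there.\<close>

lemma hat_vee_skew:
  assumes "transpose A = - A"
  shows "hat (vee A) = A"
  using skew_eq_hat [OF assms] by (metis vee_hat)

text \<open>Rotations preserve the cross product. In the derivative of the relative attitude this
  moves the commanded angular velocity to the right of \<open>E\<close>, into the body
  frame.\<close>

lemma rotation_hat:
  assumes "rotation_matrix R"
  shows "hat w ** R = R ** hat (transpose R *v w)"
proof (rule matrix_eq [THEN iffD2], rule allI)
  fix x
  have RT: "R *v (transpose R *v w) = w"
    using assms by (metis matrix_vector_mul_assoc matrix_vector_mul_lid orthogonal_matrix_def
        rotation_matrix_def)
  have "(R ** hat (transpose R *v w)) *v x = R *v (cross3 (transpose R *v w) x)"
    by (metis hat_mult_vector matrix_vector_mul_assoc)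
  also have "\<dots> = cross3 (R *v (transpose R *v w)) (R *v x)"
    by (rule cross_rotation_matrix [OF assms, symmetric])
  also have "\<dots> = (hat w ** R) *v x"
    by (simp only: RT hat_mult_vector flip: matrix_vector_mul_assoc)
  finally show "(hat w ** R) *v x = (R ** hat (transpose R *v w)) *v x" ..
qed

section \<open>Attitude error and potential as functions of a single rotation\<close>

definition attitude_error :: "real^3^3 \<Rightarrow> real^3" where
  "attitude_error E = (1/2) *\<^sub>R vee (E - transpose E)"

text \<open>At the relative attitude, \<open>attitude_error\<close> is \<open>e_R\<close> and this
  is \<open>Psi\<close>; the single matrix argument is what allows an autonomous error
  system.\<close>

definition attitude_potential :: "real^3^3 \<Rightarrow> real" where
  "attitude_potential E = 1/2 * trace (mat 1 - E)"

lemma attitude_error_eq_vector: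
  "attitude_error E =
     (1/2) *\<^sub>R vector [E$3$2 - E$2$3, E$1$3 - E$3$1, E$2$1 - E$1$2]"
proof -
  have "transpose (E - transpose E) = - (E - transpose E)"
    by (simp add: transpose_def vec_eq_iff)
  then have "E - transpose E = hat (vector [E$3$2 - E$2$3, E$1$3 - E$3$1, E$2$1 - E$1$2])"
    by (subst skew_eq_hat) (simp_all add: transpose_def)
  then have "vee (E - transpose E) = vector [E$3$2 - E$2$3, E$1$3 - E$3$1, E$2$1 - E$1$2]"
    by (simp add: vee_hat)
  then show ?thesis
    by (simp add: attitude_error_def)
qed

lemma bounded_linear_attitude_error: "bounded_linear attitude_error"
  unfolding linear_conv_bounded_linear [symmetric] linear_iff
  by (simp add: attitude_error_eq_vector vec_eq_iff forall_3 algebra_simps)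

lemma attitude_potential_eq: "attitude_potential E = (3 - trace E) / 2"
  by (simp add: attitude_potential_def trace_def mat_def sum_3)

text \<open>A trace against a skew matrix sees only the skew part of \<open>E\<close>. Along
  \<open>E' = E hat(w)\<close> this makes the derivative of the potential equal to
  \<open>attitude_error E \<bullet> w\<close>.\<close>

lemma trace_mult_hat:
  "trace (E ** hat w) = - 2 * (attitude_error E \<bullet> w)"
  by (simp add: attitude_error_eq_vector trace_def matrix_matrix_mult_def hat_eq_vector sum_3
      inner_vec_def field_simps)

lemma attitude_error_mult_hat:
  "attitude_error (E ** hat w) = (1/2) *\<^sub>R (trace E *\<^sub>R w - transpose E *v w)"
  by (simp add: attitude_error_eq_vector trace_def matrix_matrix_mult_def hat_eq_vector sum_3
      matrix_vector_mult_def transpose_def vec_eq_iff forall_3 field_simps)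

lemma rotation_matrix_rows:
  fixes E :: "real^3^3"
  assumes "rotation_matrix E"
  shows "E$i$1 * E$j$1 + E$i$2 * E$j$2 + E$i$3 * E$j$3 = (if i = j then 1 else 0)"
proof -
  have "(E ** transpose E) $ i $ j = (mat 1 :: real^3^3) $ i $ j"
    using assms by (simp add: rotation_matrix_def orthogonal_matrix_def)
  then show ?thesis
    by (simp add: matrix_matrix_mult_def transpose_def sum_3 mat_def)
qed

lemma rotation_matrix_abs_diagonal_le_1:
  fixes E :: "real^3^3"
  assumes "rotation_matrix E"
  shows "\<bar>E$i$i\<bar> \<le> 1"
proof -
  have sum: "(E$i$1)\<^sup>2 + (E$i$2)\<^sup>2 + (E$i$3)\<^sup>2 = 1"
    using rotation_matrix_rows [OF assms, of i i] by (simp add: power2_eq_square)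
  have "(E$i$1)\<^sup>2 \<le> 1" "(E$i$2)\<^sup>2 \<le> 1" "(E$i$3)\<^sup>2 \<le> 1"
    using sum zero_le_power2 [of "E$i$1"] zero_le_power2 [of "E$i$2"] zero_le_power2 [of "E$i$3"]
    by linarith+
  then have "(E$i$i)\<^sup>2 \<le> 1"
    using exhaust_3 [of i] by auto
  then show ?thesis
    by (simp add: abs_square_le_1)
qed

text \<open>Each column of a rotation is the cross product of the other two, in cyclic order,
  because rotations commute with the cross product. The diagonal components of these equations are
  the principal minors.\<close>

lemma rotation_matrix_cofactors:
  fixes E :: "real^3^3"
  assumes "rotation_matrix E"
  shows "E$1$1 * E$2$2 - E$1$2 * E$2$1 = E$3$3"
    and "E$1$1 * E$3$3 - E$1$3 * E$3$1 = E$2$2"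
    and "E$2$2 * E$3$3 - E$2$3 * E$3$2 = E$1$1"
proof -
  have *: "cross3 (column i E) (column j E) = E *v cross3 (axis i 1) (axis j 1)" for i j
    using cross_rotation_matrix [OF assms, of "axis i 1" "axis j 1"]
    by (simp add: matrix_vector_mult_basis)
  have "cross3 (column 1 E) (column 2 E) = column 3 E"
    using * [of 1 2] by (simp add: cross_basis matrix_vector_mult_basis)
  then show "E$1$1 * E$2$2 - E$1$2 * E$2$1 = E$3$3"
    by (simp add: cross3_def column_def vec_eq_iff forall_3 mult.commute)
  have "cross3 (column 3 E) (column 1 E) = column 2 E"
    using * [of 3 1] by (simp add: cross_basis matrix_vector_mult_basis)
  then show "E$1$1 * E$3$3 - E$1$3 * E$3$1 = E$2$2"
    by (simp add: cross3_def column_def vec_eq_iff forall_3 mult.commute)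
  have "cross3 (column 2 E) (column 3 E) = column 1 E"
    using * [of 2 3] by (simp add: cross_basis matrix_vector_mult_basis)
  then show "E$2$2 * E$3$3 - E$2$3 * E$3$2 = E$1$1"
    by (simp add: cross3_def column_def vec_eq_iff forall_3 mult.commute)
qed

text \<open>For a rotation by the angle \<theta> the potential is 1 - cos \<theta> and the error has
  length |sin \<theta>|, so this is sin^2 = (1 - cos)(1 + cos). The proof stays algebraic: unit rows
  remove the off-diagonal squares, and the cofactors turn products of mirrored entries into diagonal
  ones.\<close>

lemma norm_attitude_error_sq:
  assumes "rotation_matrix E"
  shows "(norm (attitude_error E))\<^sup>2 = attitude_potential E * (2 - attitude_potential E)"
proof -
  let ?T = "E$1$1 + E$2$2 + E$3$3"
  have "4 * (norm (attitude_error E))\<^sup>2 =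
      (E$3$2 - E$2$3)\<^sup>2 + (E$1$3 - E$3$1)\<^sup>2 + (E$2$1 - E$1$2)\<^sup>2"
    unfolding power2_norm_eq_inner attitude_error_eq_vector
    by (simp add: inner_vec_def sum_3 power2_eq_square field_simps)
  also have "\<dots> = (3 - ?T) * (1 + ?T)"
    using rotation_matrix_rows [OF assms, of 1 1] rotation_matrix_rows [OF assms, of 2 2]
      rotation_matrix_rows [OF assms, of 3 3] rotation_matrix_cofactors [OF assms]
    unfolding power2_eq_square by (simp add: algebra_simps)
  finally show ?thesis
    by (simp add: attitude_potential_eq trace_def sum_3 field_simps)
qed

lemma attitude_potential_nonneg:
  assumes "rotation_matrix E"
  shows "0 \<le> attitude_potential E"
  using rotation_matrix_abs_diagonal_le_1 [OF assms, of 1] rotation_matrix_abs_diagonal_le_1 [OF assms, of 2]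
    rotation_matrix_abs_diagonal_le_1 [OF assms, of 3]
  by (simp add: attitude_potential_eq trace_def sum_3)

lemma norm_attitude_error_sq_le:
  assumes "rotation_matrix E"
  shows "(norm (attitude_error E))\<^sup>2 \<le> 2 * attitude_potential E"
  by (simp add: norm_attitude_error_sq [OF assms] algebra_simps)

lemma norm_orthogonal_matrix_mult:
  fixes Q :: "real^'n^'n"
  assumes "orthogonal_matrix Q"
  shows "norm (Q *v x) = norm x"
  using assms orthogonal_transformation_matrix [of "(*v) Q"]
  by (simp add: orthogonal_transformation)

text \<open>Bounds the speed of the attitude error. The trace has modulus at most 3 and the
  transpose is an isometry, so the factor is half of 3 + 1.\<close>

lemma norm_attitude_error_mult_hat_le:
  assumes "rotation_matrix E"
  shows "norm (attitude_error (E ** hat w)) \<le> 2 * norm w"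
proof -
  have "norm (transpose E *v w) = norm w"
    using assms by (intro norm_orthogonal_matrix_mult) (simp add: rotation_matrix_def)
  moreover have "\<bar>trace E\<bar> \<le> 3"
    using rotation_matrix_abs_diagonal_le_1 [OF assms, of 1] rotation_matrix_abs_diagonal_le_1 [OF assms, of 2]
      rotation_matrix_abs_diagonal_le_1 [OF assms, of 3]
    by (simp add: trace_def sum_3)
  then have "norm (trace E *\<^sub>R w) \<le> 3 * norm w"
    by (simp add: mult_right_mono)
  ultimately have "norm (trace E *\<^sub>R w - transpose E *v w) \<le> 4 * norm w"
    using norm_triangle_ineq4 [of "trace E *\<^sub>R w" "transpose E *v w"] by linarith
  then show ?thesis
    by (simp add: attitude_error_mult_hat)
qed

text \<open>\<open>E$3$3\<close> is the cosine between the commanded and the actual thrust axis, so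
  the left side is a squared sine. It is at most 2 (1 - cos), and the other two diagonal entries are
  at most 1.\<close>

lemma one_minus_E33_sq_le:
  assumes "rotation_matrix E"
  shows "1 - (E$3$3)\<^sup>2 \<le> 4 * attitude_potential E"
proof -
  have "1 - (E$3$3)\<^sup>2 \<le> 2 * (1 - E$3$3)"
    using zero_le_power2 [of "1 - E$3$3"] by (simp add: power2_eq_square algebra_simps)
  also have "\<dots> \<le> 4 * attitude_potential E"
    using rotation_matrix_abs_diagonal_le_1 [OF assms, of 1] rotation_matrix_abs_diagonal_le_1 [OF assms, of 2]
    by (simp add: attitude_potential_eq trace_def sum_3)
  finally show ?thesis .
qed

section \<open>Exponential decay and quadratic forms\<close>

lemma derivative_nonpos_imp_le_initial:
  fixes f :: "real \<Rightarrow> real"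
  assumes deriv: "\<And>t. t \<ge> 0 \<Longrightarrow> (f has_real_derivative f' t) (at t within {0..})"
    and nonpos: "\<And>t. t \<ge> 0 \<Longrightarrow> f' t \<le> 0"
    and "t \<ge> 0"
  shows "f t \<le> f 0"
proof (rule DERIV_nonpos_imp_decreasing_open [OF \<open>t \<ge> 0\<close>])
  fix x assume "0 < x" "x < t"
  then have "at x within {0..} = at x"
    by (intro at_within_interior) simp
  with deriv [of x] nonpos [of x] \<open>0 < x\<close>
  show "\<exists>y. (f has_real_derivative y) (at x) \<and> y \<le> 0"
    by auto
next
  show "continuous_on {0..t} f"
    by (rule DERIV_continuous_on [where D = f']) (meson DERIV_subset atLeastAtMost_iff atLeast_iff deriv subsetI)
qed

text \<open>Gronwall with an integrating factor. The perturbation rate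
  \<open>C * exp (- \<beta> * t)\<close> has the finite integral \<open>C / \<beta>\<close>, so it
  costs a constant factor \<open>exp (C / \<beta>)\<close> and leaves the decay exponential.\<close>

lemma perturbed_exponential_decay:
  fixes W W' :: "real \<Rightarrow> real"
  assumes deriv: "\<And>t. t \<ge> 0 \<Longrightarrow> (W has_real_derivative W' t) (at t within {0..})"
    and le: "\<And>t. t \<ge> 0 \<Longrightarrow> W' t \<le> - \<eta> * W t + C * exp (- \<beta> * t) * (1 + W t)"
    and nonneg: "\<And>t. t \<ge> 0 \<Longrightarrow> W t \<ge> 0"
    and "\<beta> > 0" "C \<ge> 0" "t \<ge> 0"
  shows "W t \<le> (W 0 + 2 * C / \<beta>) * exp (C / \<beta>) * exp (- min \<eta> (\<beta> / 2) * t)"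
proof -
  \<comment> \<open>The cap \<open>\<beta> / 2\<close> ensures that the inhomogeneous term, of rate
    \<open>\<beta>\<close>, still decays at rate \<open>\<beta> / 2\<close> after multiplication by
    \<open>exp (\<gamma> * t)\<close>.\<close>
  define \<gamma> where "\<gamma> = min \<eta> (\<beta> / 2)"
  \<comment> \<open>The antiderivative of the perturbation rate that tends to 0 at infinity.\<close>
  define h where "h = (\<lambda>t. - (C / \<beta>) * exp (- \<beta> * t))"
  \<comment> \<open>The derivative of the second summand offsets the bound for the inhomogeneous
    term, which makes \<open>F\<close> nonincreasing.\<close>
  define F where "F = (\<lambda>t. W t * exp (\<gamma> * t - h t) + 2 * C / \<beta> * exp (C / \<beta>) * exp (- (\<beta> / 2) * t))"
  define F' where "F' = (\<lambda>t. exp (\<gamma> * t - h t) * (W' t + W t * (\<gamma> - C * exp (- \<beta> * t)))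
    - C * exp (C / \<beta>) * exp (- (\<beta> / 2) * t))"
  have h: "- (C / \<beta>) \<le> h t" "h t \<le> 0" if "t \<ge> 0" for t
    using that \<open>\<beta> > 0\<close> \<open>C \<ge> 0\<close> mult_left_mono [of "exp (- \<beta> * t)" 1 "C / \<beta>"]
    by (auto simp: h_def)
  have h': "(h has_real_derivative C * exp (- \<beta> * t)) (at t within {0..})" for t
    unfolding h_def using \<open>\<beta> > 0\<close> by (auto intro!: derivative_eq_intros)
  have "F t \<le> F 0"
  proof (rule derivative_nonpos_imp_le_initial [OF _ _ \<open>t \<ge> 0\<close>])
    fix t :: real assume t: "t \<ge> 0"
    show "(F has_real_derivative F' t) (at t within {0..})"
      unfolding F_def F'_def using \<open>\<beta> > 0\<close>
      by (auto intro!: derivative_eq_intros deriv [OF t] h' simp: field_simps)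
    have "W t * \<gamma> \<le> W t * \<eta>"
      using nonneg [OF t] by (intro mult_left_mono) (auto simp: \<gamma>_def)
    then have "W' t + W t * (\<gamma> - C * exp (- \<beta> * t)) \<le> C * exp (- \<beta> * t)"
      using le [OF t] by (simp add: algebra_simps)
    then have "exp (\<gamma> * t - h t) * (W' t + W t * (\<gamma> - C * exp (- \<beta> * t)))
        \<le> exp (\<gamma> * t - h t) * (C * exp (- \<beta> * t))"
      by (intro mult_left_mono) auto
    also have "\<dots> = C * exp (\<gamma> * t - h t - \<beta> * t)"
      by (simp add: mult_exp_exp algebra_simps)
    also have "\<dots> \<le> C * exp (C / \<beta> - (\<beta> / 2) * t)"
    proof -
      have "\<gamma> * t \<le> (\<beta> / 2) * t"
        using t by (intro mult_right_mono) (auto simp: \<gamma>_def)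
      then have "\<gamma> * t - h t - \<beta> * t \<le> C / \<beta> - (\<beta> / 2) * t"
        using h(1) [OF t] by (simp add: field_simps)
      then show ?thesis
        using \<open>C \<ge> 0\<close> by (intro mult_left_mono) auto
    qed
    also have "\<dots> = C * exp (C / \<beta>) * exp (- (\<beta> / 2) * t)"
      by (simp add: mult_exp_exp mult.assoc)
    finally show "F' t \<le> 0"
      by (simp add: F'_def)
  qed
  moreover have "W t * exp (\<gamma> * t) \<le> F t"
  proof -
    have "W t * exp (\<gamma> * t) \<le> W t * exp (\<gamma> * t - h t)"
      using nonneg h(2) \<open>t \<ge> 0\<close> by (intro mult_left_mono) auto
    then show ?thesis
      using \<open>\<beta> > 0\<close> \<open>C \<ge> 0\<close> by (simp add: F_def add_increasing2)
  qed
  moreover have "F 0 = (W 0 + 2 * C / \<beta>) * exp (C / \<beta>)"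
    by (simp add: F_def h_def algebra_simps)
  ultimately have "W t * exp (\<gamma> * t) \<le> (W 0 + 2 * C / \<beta>) * exp (C / \<beta>)"
    by simp
  then have "W t \<le> (W 0 + 2 * C / \<beta>) * exp (C / \<beta>) / exp (\<gamma> * t)"
    by (simp add: pos_le_divide_eq)
  then have "W t \<le> (W 0 + 2 * C / \<beta>) * exp (C / \<beta>) * exp (- \<gamma> * t)"
    by (simp add: exp_minus divide_inverse)
  then show ?thesis
    unfolding \<gamma>_def .
qed

text \<open>Both Lyapunov functions below are an energy plus \<open>c\<close> times a cross term. The next two lemmas say
  that for small \<open>c\<close> the damping \<open>k\<close> absorbs what the cross term contributes.\<close>

lemma cross_term_absorption:
  fixes a c k n x y :: real
  assumes "a > 0" "c > 0" "c * (n + k\<^sup>2 / (2 * a)) \<le> k / 2"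
  shows "- k * y\<^sup>2 + c * n * y\<^sup>2 - c * a * x\<^sup>2 + c * k * (x * y) \<le> - (k / 2) * y\<^sup>2 - (c * a / 2) * x\<^sup>2"
proof -
  define K where "K = k\<^sup>2 / (2 * a)"
  \<comment> \<open>Weighted Young inequality: the cross term uses up half of the damping in
    \<open>x\<close>, and \<open>K\<close> is its price in \<open>y\<close>.\<close>
  have "0 \<le> c / (2 * a) * (a * x - k * y)\<^sup>2"
    using assms by simp
  also have "\<dots> = c * a / 2 * x\<^sup>2 - c * k * (x * y) + c * K * y\<^sup>2"
    using assms by (simp add: K_def power2_eq_square field_simps)
  finally have "c * k * (x * y) \<le> c * a / 2 * x\<^sup>2 + c * K * y\<^sup>2"
    by simp
  moreover have "c * (n + K) * y\<^sup>2 \<le> k / 2 * y\<^sup>2"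
    using assms by (intro mult_right_mono) (auto simp: K_def)
  ultimately show ?thesis
    by (simp add: algebra_simps)
qed

lemma ex_small_cross_coefficient:
  fixes a k n m :: real
  assumes "a > 0" "k > 0" "n > 0" "m > 0"
  obtains c where "c > 0" "c * (n + k\<^sup>2 / (2 * a)) \<le> k / 2" "c \<le> m"
proof -
  define p where "p = n + k\<^sup>2 / (2 * a)"
  have "p > 0"
    using assms unfolding p_def by (intro add_pos_nonneg) auto
  show thesis
  proof (rule that [of "min m (k / 2 / p)"])
    show "0 < min m (k / 2 / p)"
      using assms \<open>p > 0\<close> by simp
    have "min m (k / 2 / p) \<le> k / 2 / p"
      by simp
    with \<open>p > 0\<close> show "min m (k / 2 / p) * (n + k\<^sup>2 / (2 * a)) \<le> k / 2"
      unfolding p_def [symmetric] by (simp only: pos_le_divide_eq)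
  qed simp
qed

lemma mult_le_half_sum_squares:
  fixes x y :: real
  shows "x * y \<le> (x\<^sup>2 + y\<^sup>2) / 2"
proof -
  have "2 * (x * y) \<le> x\<^sup>2 + y\<^sup>2"
    using sum_squares_bound [of x y] by (simp only: mult.assoc)
  then show ?thesis
    by (simp add: field_simps)
qed

lemma abs_inner_le_half_sum_squares:
  fixes x y :: "'a::real_inner"
  shows "\<bar>x \<bullet> y\<bar> \<le> ((norm x)\<^sup>2 + (norm y)\<^sup>2) / 2"
  by (rule order_trans [OF Cauchy_Schwarz_ineq2 mult_le_half_sum_squares])

section \<open>Quadratic forms and extreme eigenvalues\<close>

text \<open>The form attains a positive minimum on the compact unit sphere, and homogeneity extends
  the bound to all vectors.\<close>

lemma positive_definite_lower_bound:
  fixes A :: "real^'n^'n"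
  assumes "positive_definite A"
  obtains \<mu> where "\<mu> > 0" "\<And>v. \<mu> * (norm v)\<^sup>2 \<le> v \<bullet> (A *v v)"
proof -
  let ?q = "\<lambda>v. v \<bullet> (A *v v)"
  have "continuous_on (sphere 0 1) ?q"
    by (intro continuous_intros linear_continuous_on bounded_linear.linear
        matrix_vector_mul_bounded_linear)
  moreover have "axis undefined 1 \<in> sphere (0::real^'n) 1"
    by simp
  ultimately obtain u where u: "u \<in> sphere 0 1" "\<And>v. v \<in> sphere 0 1 \<Longrightarrow> ?q u \<le> ?q v"
    using continuous_attains_inf [OF compact_sphere, of 0 1 ?q] by (metis empty_iff)
  have "u \<noteq> 0"
    using u(1) by auto
  then have "?q u > 0"
    using assms by (simp add: positive_definite_def)
  moreover have "?q u * (norm v)\<^sup>2 \<le> ?q v" for v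
  proof (cases "v = 0")
    case False
    then have "?q u \<le> ?q (v /\<^sub>R norm v)"
      by (intro u(2)) simp
    then show ?thesis
      using False by (simp add: matrix_vector_mult_scaleR power2_eq_square field_simps)
  qed simp
  ultimately show thesis
    by (rule that)
qed

text \<open>Eigenvectors of distinct eigenvalues are orthogonal, and an orthogonal family in finite
  dimension is finite. Finiteness is what gives the \<open>Max\<close> in
  \<open>max_eigenvalue\<close> its meaning.\<close>

lemma finite_eigenvalues_symmetric:
  fixes A :: "real^'n^'n"
  assumes "transpose A = A"
  shows "finite {c. \<exists>v. v \<noteq> 0 \<and> A *v v = c *\<^sub>R v}" (is "finite ?S")
proof -
  have "\<forall>c\<in>?S. \<exists>v. v \<noteq> 0 \<and> A *v v = c *\<^sub>R v"
    by simp
  then obtain f where f: "\<And>c. c \<in> ?S \<Longrightarrow> f c \<noteq> 0 \<and> A *v f c = c *\<^sub>R f c"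
    unfolding bchoice_iff by blast
  have orth: "f c \<bullet> f d = 0" if "c \<in> ?S" "d \<in> ?S" "c \<noteq> d" for c d
  proof -
    have "c * (f c \<bullet> f d) = (A *v f c) \<bullet> f d"
      using f that by simp
    also have "\<dots> = d * (f c \<bullet> f d)"
      using f [OF that(2)] inner_matrix_vector_transpose [of "f c" A "f d"] assms by simp
    finally show ?thesis
      using that by simp
  qed
  have "inj_on f ?S"
  proof (rule inj_onI)
    fix c d assume *: "c \<in> ?S" "d \<in> ?S" "f c = f d"
    then have "f c \<bullet> f d \<noteq> 0"
      using f by simp
    with orth * show "c = d"
      by blast
  qed
  moreover have "pairwise orthogonal (f ` ?S)"
  proof (rule pairwiseI)
    fix x y assume *: "x \<in> f ` ?S" "y \<in> f ` ?S" "x \<noteq> y"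
    then obtain c d where "c \<in> ?S" "d \<in> ?S" "x = f c" "y = f d"
      by blast
    with orth * show "orthogonal x y"
      unfolding orthogonal_def by blast
  qed
  then have "finite (f ` ?S)"
    by (rule pairwise_orthogonal_imp_finite)
  ultimately show ?thesis
    by (rule finite_imageD [rotated])
qed

text \<open>The maximum \<open>l\<close> of the form on the unit sphere is itself an eigenvalue,
  since a maximiser \<open>u\<close> is an eigenvector; hence it is at most the largest one.\<close>

lemma quadratic_form_le_max_eigenvalue:
  fixes A :: "real^'n^'n"
  assumes sym: "transpose A = A"
  shows "v \<bullet> (A *v v) \<le> max_eigenvalue A * (norm v)\<^sup>2"
proof -
  let ?q = "\<lambda>v. v \<bullet> (A *v v)"
  have "continuous_on (sphere 0 1) ?q"
    by (intro continuous_intros linear_continuous_on bounded_linear.linear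
        matrix_vector_mul_bounded_linear)
  moreover have "axis undefined 1 \<in> sphere (0::real^'n) 1"
    by simp
  ultimately obtain u where u: "u \<in> sphere 0 1" "\<And>v. v \<in> sphere 0 1 \<Longrightarrow> ?q v \<le> ?q u"
    using continuous_attains_sup [OF compact_sphere, of 0 1 ?q] by (metis empty_iff)
  define l where "l = ?q u"
  have le: "?q v \<le> l * (norm v)\<^sup>2" for v
  proof (cases "v = 0")
    case False
    then have "?q (v /\<^sub>R norm v) \<le> l"
      unfolding l_def by (intro u(2)) simp
    then show ?thesis
      using False by (simp add: matrix_vector_mult_scaleR power2_eq_square field_simps)
  qed simp
  have "A *v u = l *\<^sub>R u"
  proof -
    \<comment> \<open>The residual of the eigenvector equation; a variation of \<open>u\<close> in
      this very direction forces it to vanish.\<close>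
    define w where "w = l *\<^sub>R u - A *v u"
    have sw: "u \<bullet> (A *v w) = (A *v u) \<bullet> w"
      using inner_matrix_vector_transpose [of u A w] sym by simp
    have uu: "u \<bullet> u = 1"
      using u(1) by (simp flip: power2_norm_eq_inner)
    \<comment> \<open>\<open>l * (v \<bullet> v) - ?q v\<close> is nonnegative and vanishes at
      \<open>u\<close>. On the line \<open>u + s *\<^sub>R w\<close> it is therefore a quadratic in
      \<open>s\<close> without constant term, with slope \<open>2 * (w \<bullet> w)\<close> at
      0.\<close>
    have quad: "0 \<le> 2 * (w \<bullet> w) * s + (l * (w \<bullet> w) - ?q w) * s\<^sup>2" for s
    proof -
      have "0 \<le> l * ((u + s *\<^sub>R w) \<bullet> (u + s *\<^sub>R w)) - ?q (u + s *\<^sub>R w)"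
        using le [of "u + s *\<^sub>R w"] by (simp add: power2_norm_eq_inner)
      also have "\<dots> = l * (u \<bullet> u) - ?q u + s * (2 * (l * (u \<bullet> w)) - (u \<bullet> (A *v w)) - w \<bullet> (A *v u))
          + s\<^sup>2 * (l * (w \<bullet> w) - ?q w)"
        by (simp add: matrix_vector_right_distrib matrix_vector_mult_scaleR inner_add_left
            inner_add_right inner_commute [of w u] power2_eq_square algebra_simps)
      also have "2 * (l * (u \<bullet> w)) - (u \<bullet> (A *v w)) - w \<bullet> (A *v u) = 2 * (w \<bullet> w)"
        unfolding sw by (simp add: w_def inner_diff_left inner_diff_right inner_commute algebra_simps)
      finally show ?thesis
        using uu by (simp add: l_def algebra_simps)
    qed
    have "w \<bullet> w \<le> 0"
    proof (rule ccontr)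
      assume "\<not> w \<bullet> w \<le> 0"
      then have ww: "w \<bullet> w > 0"
        by linarith
      \<comment> \<open>\<open>p\<close> dominates the quadratic coefficient, so at
        \<open>- s\<close> with \<open>s = (w \<bullet> w) / p\<close> the linear term wins and the
        quadratic would be negative.\<close>
      define p where "p = \<bar>l * (w \<bullet> w) - ?q w\<bar> + 1"
      have "p > 0" by (simp add: p_def)
      define s where "s = (w \<bullet> w) / p"
      have "s > 0" using \<open>p > 0\<close> ww by (simp add: s_def)
      have "0 \<le> - 2 * (w \<bullet> w) * s + (l * (w \<bullet> w) - ?q w) * s\<^sup>2"
        using quad [of "- s"] by simp
      also have "\<dots> \<le> - 2 * (w \<bullet> w) * s + p * s\<^sup>2"
        by (intro add_left_mono mult_right_mono) (auto simp: p_def)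
      also have "\<dots> = - (w \<bullet> w) * s"
        using \<open>p > 0\<close> by (simp add: s_def power2_eq_square field_simps)
      also have "\<dots> < 0"
        using \<open>s > 0\<close> ww by (simp add: mult_pos_pos)
      finally show False by simp
    qed
    then have "w \<bullet> w = 0"
      using inner_ge_zero [of w] by linarith
    then show ?thesis
      by (simp add: w_def)
  qed
  moreover have "u \<noteq> 0"
    using u(1) by force
  ultimately have "l \<le> max_eigenvalue A"
    unfolding max_eigenvalue_def
    by (intro Max_ge finite_eigenvalues_symmetric [OF sym]) auto
  then have "l * (norm v)\<^sup>2 \<le> max_eigenvalue A * (norm v)\<^sup>2"
    by (intro mult_right_mono) auto
  with le [of v] show ?thesis
    by linarith
qed

section \<open>Decay of the attitude and position errors\<close>

text \<open>The rotational error system detached from position and command. The acceleration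
  equation keeps its factor \<open>J\<close>, so that no inverse of the inertia appears.\<close>

definition attitude_error_motion ::
    "real^3^3 \<Rightarrow> real \<Rightarrow> real \<Rightarrow> (real \<Rightarrow> real^3^3) \<Rightarrow> (real \<Rightarrow> real^3) \<Rightarrow> bool" where
  "attitude_error_motion J a k E w \<longleftrightarrow>
     (\<forall>t\<ge>0. rotation_matrix (E t) \<and>
       (E has_vector_derivative E t ** hat (w t)) (at t within {0..}) \<and>
       (\<exists>D. (w has_vector_derivative D) (at t within {0..}) \<and>
         J *v D = - a *\<^sub>R attitude_error (E t) - k *\<^sub>R w t))"

definition attitude_energy :: "real^3^3 \<Rightarrow> real \<Rightarrow> real^3^3 \<Rightarrow> real^3 \<Rightarrow> real" where
  "attitude_energy J a E w = 1/2 * (w \<bullet> (J *v w)) + a * attitude_potential E"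

lemma has_real_derivative_inner:
  fixes f g :: "real \<Rightarrow> 'a::real_inner"
  assumes "(f has_vector_derivative f') (at t within S)" "(g has_vector_derivative g') (at t within S)"
  shows "((\<lambda>t. f t \<bullet> g t) has_real_derivative f t \<bullet> g' + f' \<bullet> g t) (at t within S)"
  using bounded_bilinear.has_vector_derivative [OF bounded_bilinear_inner assms]
  by (simp add: has_real_derivative_iff_has_vector_derivative)

lemma has_real_derivative_quadratic_form:
  fixes A :: "real^'n^'n"
  assumes "transpose A = A" "(w has_vector_derivative D) (at t within S)"
  shows "((\<lambda>t. w t \<bullet> (A *v w t)) has_real_derivative 2 * (w t \<bullet> (A *v D))) (at t within S)"
proof -
  have "((\<lambda>t. A *v w t) has_vector_derivative A *v D) (at t within S)"
    by (rule bounded_linear.has_vector_derivative [OF matrix_vector_mul_bounded_linear assms(2)])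
  from has_real_derivative_inner [OF assms(2) this]
  have "((\<lambda>t. w t \<bullet> (A *v w t)) has_real_derivative w t \<bullet> (A *v D) + D \<bullet> (A *v w t)) (at t within S)" .
  moreover have "D \<bullet> (A *v w t) = w t \<bullet> (A *v D)"
    using inner_matrix_vector_transpose [of D A "w t"] assms(1) by (simp add: inner_commute)
  ultimately show ?thesis
    by simp
qed

lemma has_real_derivative_attitude_potential:
  assumes "(E has_vector_derivative E t ** hat w) (at t within S)"
  shows "((\<lambda>t. attitude_potential (E t)) has_real_derivative attitude_error (E t) \<bullet> w) (at t within S)"
proof -
  have "((\<lambda>t. trace (E t)) has_real_derivative - 2 * (attitude_error (E t) \<bullet> w)) (at t within S)"
    using bounded_linear.has_vector_derivative [OF bounded_linear_trace assms]
    by (simp add: has_real_derivative_iff_has_vector_derivative trace_mult_hat)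
  then show ?thesis
    unfolding attitude_potential_eq by (auto intro!: derivative_eq_intros)
qed

text \<open>The power of the restoring moment cancels the change of the potential, which leaves only
  the damping \<open>- k * (w t \<bullet> w t)\<close>.\<close>

lemma attitude_energy_le_initial:
  assumes mot: "attitude_error_motion J a k E w" and "positive_definite J" "k \<ge> 0" "t \<ge> 0"
  shows "attitude_energy J a (E t) (w t) \<le> attitude_energy J a (E 0) (w 0)"
proof (rule derivative_nonpos_imp_le_initial [OF _ _ \<open>t \<ge> 0\<close>, where f' = "\<lambda>t. - k * (w t \<bullet> w t)"])
  fix t :: real assume t: "t \<ge> 0"
  with mot obtain D where
    E: "(E has_vector_derivative E t ** hat (w t)) (at t within {0..})" and
    w: "(w has_vector_derivative D) (at t within {0..})" and
    D: "J *v D = - a *\<^sub>R attitude_error (E t) - k *\<^sub>R w t"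
    unfolding attitude_error_motion_def by blast
  have J: "transpose J = J"
    using assms by (simp add: positive_definite_def)
  show "((\<lambda>t. attitude_energy J a (E t) (w t)) has_real_derivative - k * (w t \<bullet> w t)) (at t within {0..})"
    unfolding attitude_energy_def
    by (rule derivative_eq_intros has_real_derivative_quadratic_form [OF J w]
        has_real_derivative_attitude_potential [OF E] refl)+
      (simp add: D inner_diff_right inner_commute field_simps)
  show "- k * (w t \<bullet> w t) \<le> 0"
    using \<open>k \<ge> 0\<close> by simp
qed

text \<open>The constants depend only on \<open>J\<close>, the gains and \<open>\<psi>\<close>, so
  they serve all motions at once. The gap \<open>2 - \<psi>\<close> keeps motions away from
  rotations by 180 degrees, where the attitude error vanishes although the potential is 2.\<close>

lemma attitude_error_decay:
  assumes J: "positive_definite J" and "a > 0" "k > 0" "\<psi> < 2"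
  obtains \<alpha> \<beta> where "\<alpha> > 0" "\<beta> > 0"
    "\<And>E w t. \<lbrakk>attitude_error_motion J a k E w; attitude_energy J a (E 0) (w 0) \<le> a * \<psi>; t \<ge> 0\<rbrakk>
       \<Longrightarrow> attitude_potential (E t) + (norm (w t))\<^sup>2 \<le> \<alpha> * exp (- \<beta> * t)"
proof -
  obtain \<mu> where \<mu>: "\<mu> > 0" "\<And>v. \<mu> * (norm v)\<^sup>2 \<le> v \<bullet> (J *v v)"
    by (rule positive_definite_lower_bound [OF J]) blast
  obtain N where N: "N > 0" "\<And>v. norm (J *v v) \<le> N * norm v"
    using bounded_linear.pos_bounded [OF matrix_vector_mul_bounded_linear [of J]]
    by (auto simp: mult.commute)
  obtain c where c: "c > 0" "c * (2 * N + k\<^sup>2 / (2 * a)) \<le> k / 2" "c \<le> min (\<mu> / 2) (a / 2) / N"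
    by (rule ex_small_cross_coefficient [of a k "2 * N" "min (\<mu> / 2) (a / 2) / N"])
      (use \<mu> N assms in auto)
  \<comment> \<open>With these bounds the cross term takes at most half of the energy's lower
    bound.\<close>
  have cN: "c * N \<le> \<mu> / 2" "c * N \<le> a / 2"
    using c(3) N by (simp_all add: pos_le_divide_eq)
  \<comment> \<open>\<open>l\<close> and \<open>u\<close> compare the Lyapunov function with squared
    errors from below and above, \<open>\<eta>\<close> is its decay rate, and \<open>M\<close>
    bounds the initial squared errors through the energy. The absolute values in \<open>M\<close>
    and its summand 1 give positivity without a sign condition on \<open>\<psi>\<close>.\<close>
  define l where "l = min (a / 2) (\<mu> / 4)"
  define u where "u = N + \<mu> + a / (2 - \<psi>) + a"
  define \<eta> where "\<eta> = min (k / 2) (c * a / 2) / u"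
  define M where "M = 2 * \<bar>\<psi>\<bar> + 2 * a * \<bar>\<psi>\<bar> / \<mu> + 1"
  have pos: "l > 0" "u > 0" "\<eta> > 0"
    using \<mu> N assms c by (auto simp: l_def u_def \<eta>_def intro!: divide_pos_pos add_pos_pos)
  have "M > 0"
    unfolding M_def using \<mu> assms by (intro add_nonneg_pos add_nonneg_nonneg) auto
  have decay: "attitude_potential (E t) + (norm (w t))\<^sup>2 \<le> u * M / l * exp (- min \<eta> (1 / 2) * t)"
    if mot: "attitude_error_motion J a k E w"
      and init: "attitude_energy J a (E 0) (w 0) \<le> a * \<psi>" and "t \<ge> 0" for E w t
  proof -
    txt \<open>The energy does not decay at rest in \<open>attitude_error \<noteq> 0\<close>; the cross term repairs this.\<close>
    define W where "W = (\<lambda>t. attitude_energy J a (E t) (w t) + c * (attitude_error (E t) \<bullet> (J *v w t)))"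
    \<comment> \<open>The derivative of \<open>W\<close>, with \<open>J *v D\<close> replaced by the
      right-hand side of the error equation and the conservative terms cancelled.\<close>
    define W' where "W' = (\<lambda>t. - k * (w t \<bullet> w t)
       + c * (attitude_error (E t) \<bullet> (- a *\<^sub>R attitude_error (E t) - k *\<^sub>R w t)
              + attitude_error (E t ** hat (w t)) \<bullet> (J *v w t)))"
    have rot: "rotation_matrix (E t)" if "t \<ge> 0" for t
      using mot that by (simp add: attitude_error_motion_def)
    note P0 = attitude_potential_nonneg [OF rot]
    have energy: "attitude_energy J a (E t) (w t) \<le> a * \<psi>" if "t \<ge> 0" for t
      using attitude_energy_le_initial [OF mot J _ that] init \<open>k > 0\<close> by simp
    have P: "attitude_potential (E t) \<le> \<psi>" and w2: "\<mu> * (norm (w t))\<^sup>2 \<le> 2 * (a * \<psi>)" if "t \<ge> 0" for t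
    proof -
      have "a * attitude_potential (E t) \<ge> 0" "\<mu> * (norm (w t))\<^sup>2 \<ge> 0"
        using P0 [OF that] \<open>a > 0\<close> \<mu> by simp_all
      then show "\<mu> * (norm (w t))\<^sup>2 \<le> 2 * (a * \<psi>)"
        using energy [OF that] \<mu>(2) [of "w t"] unfolding attitude_energy_def by linarith
      have "a * attitude_potential (E t) \<le> a * \<psi>"
        using energy [OF that] \<mu>(2) [of "w t"] \<open>\<mu> * (norm (w t))\<^sup>2 \<ge> 0\<close>
        unfolding attitude_energy_def by linarith
      with \<open>a > 0\<close> show "attitude_potential (E t) \<le> \<psi>"
        by simp
    qed
    \<comment> \<open>The gap below 2 enters here: the factor
      \<open>2 - attitude_potential (E t)\<close> in the squared error is at least
      \<open>2 - \<psi>\<close>.\<close>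
    have Pe: "attitude_potential (E t) \<le> (norm (attitude_error (E t)))\<^sup>2 / (2 - \<psi>)" if "t \<ge> 0" for t
    proof -
      have "attitude_potential (E t) * (2 - \<psi>) \<le> attitude_potential (E t) * (2 - attitude_potential (E t))"
        using P [OF that] P0 [OF that] by (intro mult_left_mono) auto
      then show ?thesis
        using \<open>\<psi> < 2\<close> by (simp add: pos_le_divide_eq norm_attitude_error_sq [OF rot [OF that]])
    qed
    have cross: "\<bar>c * (attitude_error (E t) \<bullet> (J *v w t))\<bar>
        \<le> c * N / 2 * ((norm (attitude_error (E t)))\<^sup>2 + (norm (w t))\<^sup>2)" for t
    proof -
      have "\<bar>attitude_error (E t) \<bullet> (J *v w t)\<bar> \<le> norm (attitude_error (E t)) * (N * norm (w t))"
        by (rule order_trans [OF Cauchy_Schwarz_ineq2]) (intro mult_left_mono N; simp)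
      also have "\<dots> \<le> N * (((norm (attitude_error (E t)))\<^sup>2 + (norm (w t))\<^sup>2) / 2)"
        using mult_left_mono [OF mult_le_half_sum_squares [of "norm (attitude_error (E t))" "norm (w t)"], of N] N
        by (simp add: mult.left_commute)
      finally show ?thesis
        using c(1) by (simp add: abs_mult mult_left_mono mult.assoc)
    qed
    have lower: "l * (attitude_potential (E t) + (norm (w t))\<^sup>2) \<le> W t" if "t \<ge> 0" for t
    proof -
      have "c * N / 2 * ((norm (attitude_error (E t)))\<^sup>2 + (norm (w t))\<^sup>2)
          \<le> a / 4 * (norm (attitude_error (E t)))\<^sup>2 + \<mu> / 4 * (norm (w t))\<^sup>2"
        unfolding distrib_left using cN by (intro add_mono mult_right_mono) (simp_all add: mult.commute)
      also have "\<dots> \<le> a / 2 * attitude_potential (E t) + \<mu> / 4 * (norm (w t))\<^sup>2"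
        using norm_attitude_error_sq_le [OF rot [OF that]] \<open>a > 0\<close> by simp
      finally have "a / 2 * attitude_potential (E t) + \<mu> / 4 * (norm (w t))\<^sup>2 \<le> W t"
        using cross [of t] \<mu>(2) [of "w t"] unfolding W_def attitude_energy_def
        by (simp add: abs_le_iff)
      moreover have "l * (attitude_potential (E t) + (norm (w t))\<^sup>2)
          \<le> a / 2 * attitude_potential (E t) + \<mu> / 4 * (norm (w t))\<^sup>2"
        unfolding distrib_left using P0 [OF that] by (intro add_mono mult_right_mono) (auto simp: l_def)
      ultimately show ?thesis
        by linarith
    qed
    have energy_le: "W t \<le> (N / 2 + \<mu> / 4) * (norm (w t))\<^sup>2 + a * attitude_potential (E t)
        + a / 4 * (norm (attitude_error (E t)))\<^sup>2" for t
    proof -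
      have "w t \<bullet> (J *v w t) \<le> norm (w t) * (N * norm (w t))"
        by (rule order_trans [OF norm_cauchy_schwarz]) (intro mult_left_mono N; simp)
      moreover have "c * N / 2 * ((norm (attitude_error (E t)))\<^sup>2 + (norm (w t))\<^sup>2)
          \<le> a / 4 * (norm (attitude_error (E t)))\<^sup>2 + \<mu> / 4 * (norm (w t))\<^sup>2"
        unfolding distrib_left using cN by (intro add_mono mult_right_mono) (simp_all add: mult.commute)
      ultimately show ?thesis
        using cross [of t] unfolding W_def attitude_energy_def
        by (simp add: abs_le_iff power2_eq_square algebra_simps)
    qed
    have upper: "W t \<le> u * ((norm (attitude_error (E t)))\<^sup>2 + (norm (w t))\<^sup>2)" if "t \<ge> 0" for t
    proof -
      have "a * attitude_potential (E t) \<le> a / (2 - \<psi>) * (norm (attitude_error (E t)))\<^sup>2"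
        using mult_left_mono [OF Pe [OF that], of a] \<open>a > 0\<close> by simp
      then have "W t \<le> (a / (2 - \<psi>) + a / 4) * (norm (attitude_error (E t)))\<^sup>2 + (N / 2 + \<mu> / 4) * (norm (w t))\<^sup>2"
        using energy_le [of t] by (simp add: distrib_right)
      also have "\<dots> \<le> u * (norm (attitude_error (E t)))\<^sup>2 + u * (norm (w t))\<^sup>2"
      proof -
        have "0 < a / (2 - \<psi>)"
          using assms by simp
        then have "a / (2 - \<psi>) + a / 4 \<le> u" "N / 2 + \<mu> / 4 \<le> u"
          unfolding u_def using \<mu>(1) N(1) \<open>a > 0\<close> by linarith+
        then show ?thesis
          by (intro add_mono mult_right_mono) auto
      qed
      finally show ?thesis
        by (simp add: distrib_left)
    qed
    have deriv: "(W has_real_derivative W' t) (at t within {0..})" if t: "t \<ge> 0" for t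
    proof -
      from mot t obtain D where
        E: "(E has_vector_derivative E t ** hat (w t)) (at t within {0..})" and
        w: "(w has_vector_derivative D) (at t within {0..})" and
        D: "J *v D = - a *\<^sub>R attitude_error (E t) - k *\<^sub>R w t"
        unfolding attitude_error_motion_def by blast
      have sym: "transpose J = J"
        using J by (simp add: positive_definite_def)
      have "((\<lambda>t. attitude_error (E t) \<bullet> (J *v w t)) has_real_derivative
          attitude_error (E t) \<bullet> (J *v D) + attitude_error (E t ** hat (w t)) \<bullet> (J *v w t)) (at t within {0..})"
        by (intro has_real_derivative_inner bounded_linear.has_vector_derivative [OF bounded_linear_attitude_error]
            bounded_linear.has_vector_derivative [OF matrix_vector_mul_bounded_linear] E w)
      note cross' = this [unfolded D]
      show ?thesis
        unfolding W_def W'_def attitude_energy_def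
        by (rule derivative_eq_intros has_real_derivative_quadratic_form [OF sym w] cross'
            has_real_derivative_attitude_potential [OF E] refl)+
          (simp add: D inner_diff_right inner_commute field_simps)
    qed
    have W'_le: "W' t \<le> - \<eta> * W t" if t: "t \<ge> 0" for t
    proof -
      define e where "e = norm (attitude_error (E t))"
      define n where "n = norm (w t)"
      have "attitude_error (E t ** hat (w t)) \<bullet> (J *v w t) \<le> (2 * n) * (N * n)"
        unfolding n_def using norm_attitude_error_mult_hat_le [OF rot [OF t]] N
        by (intro order_trans [OF norm_cauchy_schwarz] mult_mono) auto
      moreover have "- (attitude_error (E t) \<bullet> w t) \<le> e * n"
        unfolding e_def n_def using Cauchy_Schwarz_ineq2 [of "attitude_error (E t)" "w t"] by linarith
      then have "k * - (attitude_error (E t) \<bullet> w t) \<le> k * (e * n)"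
        using \<open>k > 0\<close> by (intro mult_left_mono) auto
      ultimately have "attitude_error (E t) \<bullet> (- a *\<^sub>R attitude_error (E t) - k *\<^sub>R w t)
          + attitude_error (E t ** hat (w t)) \<bullet> (J *v w t) \<le> - a * e\<^sup>2 + k * (e * n) + 2 * N * n\<^sup>2"
        by (simp add: inner_diff_right e_def power2_norm_eq_inner [symmetric] power2_eq_square algebra_simps)
      then have "c * (attitude_error (E t) \<bullet> (- a *\<^sub>R attitude_error (E t) - k *\<^sub>R w t)
          + attitude_error (E t ** hat (w t)) \<bullet> (J *v w t)) \<le> c * (- a * e\<^sup>2 + k * (e * n) + 2 * N * n\<^sup>2)"
        using c(1) by (intro mult_left_mono) auto
      then have "W' t \<le> - k * n\<^sup>2 + c * (2 * N) * n\<^sup>2 - c * a * e\<^sup>2 + c * k * (e * n)"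
        by (simp add: W'_def n_def power2_norm_eq_inner algebra_simps)
      also have "\<dots> \<le> - (k / 2) * n\<^sup>2 - (c * a / 2) * e\<^sup>2"
        by (rule cross_term_absorption [OF \<open>a > 0\<close> c(1,2)])
      also have "\<dots> \<le> - (\<eta> * u) * (e\<^sup>2 + n\<^sup>2)"
      proof -
        have "\<eta> * u \<le> k / 2" "\<eta> * u \<le> c * a / 2"
          using pos by (simp_all add: \<eta>_def)
        then have "(\<eta> * u) * n\<^sup>2 \<le> k / 2 * n\<^sup>2" "(\<eta> * u) * e\<^sup>2 \<le> c * a / 2 * e\<^sup>2"
          by (intro mult_right_mono; simp)+
        then show ?thesis
          by (simp add: algebra_simps)
      qed
      also have "\<dots> \<le> - \<eta> * W t"
        using mult_left_mono [OF upper [OF t], of \<eta>] pos by (simp add: e_def n_def mult.assoc)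
      finally show ?thesis .
    qed
    have W0: "W t \<ge> 0" if "t \<ge> 0" for t
      using lower [OF that] P0 [OF that] pos by (meson add_nonneg_nonneg mult_nonneg_nonneg less_imp_le order_trans zero_le_power2)
    \<comment> \<open>The unperturbed case \<open>C = 0\<close>; the value 1 for
      \<open>\<beta>\<close> is arbitrary and is the origin of the \<open>1 / 2\<close> in the
      rate.\<close>
    have "W t \<le> W 0 * exp (- min \<eta> (1 / 2) * t)"
      using perturbed_exponential_decay [OF deriv _ W0, where \<beta> = 1 and C = 0 and \<eta> = \<eta> and t = t] W'_le \<open>t \<ge> 0\<close>
      by simp
    also have "W 0 \<le> u * M"
    proof -
      have "(norm (attitude_error (E 0)))\<^sup>2 \<le> 2 * \<bar>\<psi>\<bar>"
        using norm_attitude_error_sq_le [OF rot, of 0] P [of 0] by simp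
      moreover have "(norm (w 0))\<^sup>2 \<le> 2 * a * \<bar>\<psi>\<bar> / \<mu>"
      proof -
        have "\<mu> * (norm (w 0))\<^sup>2 \<le> 2 * a * \<bar>\<psi>\<bar>"
        proof -
          have "a * \<psi> \<le> a * \<bar>\<psi>\<bar>"
            using \<open>a > 0\<close> by (intro mult_left_mono) auto
          with w2 [of 0] show ?thesis
            unfolding mult.assoc by linarith
        qed
        then show ?thesis
          using \<mu> by (simp add: field_simps)
      qed
      ultimately have "(norm (attitude_error (E 0)))\<^sup>2 + (norm (w 0))\<^sup>2 \<le> M"
        unfolding M_def by linarith
      then show ?thesis
        by (intro order_trans [OF upper mult_left_mono]) (use pos in simp_all)
    qed
    finally have "l * (attitude_potential (E t) + (norm (w t))\<^sup>2)
        \<le> u * M * exp (- min \<eta> (1 / 2) * t)"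
      using lower [OF \<open>t \<ge> 0\<close>] by (simp add: mult_right_mono)
    then show ?thesis
      using pos by (simp add: pos_le_divide_eq mult.commute)
  qed
  show thesis
  proof (rule that [of "u * M / l" "min \<eta> (1 / 2)"])
    show "0 < u * M / l"
      using pos \<open>M > 0\<close> by simp
    show "0 < min \<eta> (1 / 2)"
      using pos by simp
  qed (rule decay)
qed

section \<open>Translational error dynamics\<close>

text \<open>A damped oscillator with the Lyapunov function energy plus
  \<open>c * m * (x t \<bullet> v t)\<close>. The disturbance \<open>X\<close> may grow linearly
  with the state; multiplied by a velocity it grows like \<open>1 + W\<close>, and its decaying
  factor makes the Gronwall estimate applicable.\<close>

lemma perturbed_translation_decay:
  fixes m a k B C \<beta> \<delta> :: real
  assumes "m > 0" "a > 0" "k > 0" "B \<ge> 0" "C \<ge> 0" "\<beta> > 0" "\<delta> \<ge> 0"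
  obtains \<alpha> \<gamma> where "\<alpha> > 0" "\<gamma> > 0"
    "\<And>(x :: real \<Rightarrow> 'a::real_inner) v X t.
       \<lbrakk>\<And>t. t \<ge> 0 \<Longrightarrow> (x has_vector_derivative v t) (at t within {0..});
        \<And>t. t \<ge> 0 \<Longrightarrow> (v has_vector_derivative (- a *\<^sub>R x t - k *\<^sub>R v t - X t) /\<^sub>R m) (at t within {0..});
        \<And>t. t \<ge> 0 \<Longrightarrow> norm (X t) \<le> C * exp (- \<beta> * t) * (B + a * norm (x t) + k * norm (v t));
        norm (x 0) \<le> \<delta>; norm (v 0) \<le> \<delta>; t \<ge> 0\<rbrakk>
       \<Longrightarrow> (norm (x t))\<^sup>2 + (norm (v t))\<^sup>2 \<le> \<alpha> * exp (- \<gamma> * t)"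
proof -
  obtain c where c: "c > 0" "c * (m + k\<^sup>2 / (2 * a)) \<le> k / 2" "c \<le> min (a / 2) (m / 2) / m"
    by (rule ex_small_cross_coefficient [of a k m "min (a / 2) (m / 2) / m"])
      (use assms in auto)
  have cm: "c * m \<le> a / 2" "c * m \<le> m / 2"
    using c(3) assms by (simp_all add: pos_le_divide_eq)
  define l where "l = min (a / 4) (m / 4)"
  define u where "u = a + m"
  define \<eta> where "\<eta> = min (k / 2) (c * a / 2) / u"
  \<comment> \<open>Collects the disturbance constants: \<open>(1 + c) * (B + a + k)\<close> from
    bounding all monomials by \<open>1 + n t\<close>, and \<open>1 + 1 / l\<close> from passing to
    \<open>1 + W t\<close>.\<close>
  define C' where "C' = C * ((1 + c) * (B + a + k) * (1 + 1 / l))"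
  have pos: "l > 0" "u > 0" "\<eta> > 0" "C' \<ge> 0"
    using assms c by (auto simp: l_def u_def \<eta>_def C'_def intro!: divide_pos_pos add_pos_pos)
  have decay: "(norm (x t))\<^sup>2 + (norm (v t))\<^sup>2
      \<le> (2 * u * \<delta>\<^sup>2 + 2 * C' / \<beta> + 1) * exp (C' / \<beta>) / l * exp (- min \<eta> (\<beta> / 2) * t)"
    if x: "\<And>t. t \<ge> 0 \<Longrightarrow> (x has_vector_derivative v t) (at t within {0..})"
      and v: "\<And>t. t \<ge> 0 \<Longrightarrow> (v has_vector_derivative (- a *\<^sub>R x t - k *\<^sub>R v t - X t) /\<^sub>R m) (at t within {0..})"
      and X: "\<And>t. t \<ge> 0 \<Longrightarrow> norm (X t) \<le> C * exp (- \<beta> * t) * (B + a * norm (x t) + k * norm (v t))"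
      and init: "norm (x 0) \<le> \<delta>" "norm (v 0) \<le> \<delta>" and "t \<ge> 0"
    for x v X :: "real \<Rightarrow> 'a" and t
  proof -
    define n where "n = (\<lambda>t. (norm (x t))\<^sup>2 + (norm (v t))\<^sup>2)"
    define W where "W = (\<lambda>t. a / 2 * (x t \<bullet> x t) + m / 2 * (v t \<bullet> v t) + c * m * (x t \<bullet> v t))"
    define W' where "W' = (\<lambda>t. a * (x t \<bullet> v t) + (v t + c *\<^sub>R x t) \<bullet> (- a *\<^sub>R x t - k *\<^sub>R v t - X t) + c * m * (v t \<bullet> v t))"
    have n0: "n t \<ge> 0" for t
      by (simp add: n_def)
    have cross: "\<bar>c * m * (x t \<bullet> v t)\<bar> \<le> a / 4 * (norm (x t))\<^sup>2 + m / 4 * (norm (v t))\<^sup>2" for t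
    proof -
      have "\<bar>c * m * (x t \<bullet> v t)\<bar> \<le> c * m * (((norm (x t))\<^sup>2 + (norm (v t))\<^sup>2) / 2)"
        using abs_inner_le_half_sum_squares [of "x t" "v t"] c assms by (simp add: abs_mult mult_left_mono)
      also have "\<dots> = (c * m / 2) * (norm (x t))\<^sup>2 + (c * m / 2) * (norm (v t))\<^sup>2"
        by (simp add: field_simps)
      also have "\<dots> \<le> a / 4 * (norm (x t))\<^sup>2 + m / 4 * (norm (v t))\<^sup>2"
        using cm by (intro add_mono mult_right_mono) simp_all
      finally show ?thesis .
    qed
    have lower: "l * n t \<le> W t" for t
    proof -
      have "l * n t \<le> a / 4 * (norm (x t))\<^sup>2 + m / 4 * (norm (v t))\<^sup>2"
        unfolding n_def distrib_left by (intro add_mono mult_right_mono) (auto simp: l_def)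
      then show ?thesis
        using cross [of t] by (simp add: W_def power2_norm_eq_inner abs_le_iff)
    qed
    have upper: "W t \<le> u * n t" for t
    proof -
      have "W t \<le> (3 * a / 4) * (norm (x t))\<^sup>2 + (3 * m / 4) * (norm (v t))\<^sup>2"
        using cross [of t] by (simp add: W_def power2_norm_eq_inner abs_le_iff)
      also have "\<dots> \<le> u * (norm (x t))\<^sup>2 + u * (norm (v t))\<^sup>2"
        using assms by (intro add_mono mult_right_mono) (auto simp: u_def)
      finally show ?thesis
        by (simp add: n_def distrib_left)
    qed
    have deriv: "(W has_real_derivative W' t) (at t within {0..})" if t: "t \<ge> 0" for t
      unfolding W_def W'_def
      by (rule derivative_eq_intros has_real_derivative_inner x [OF t] v [OF t] refl)+
        (use \<open>m > 0\<close> in \<open>simp add: inner_add_left inner_add_right inner_diff_left inner_diff_right inner_commute field_simps\<close>)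
    have W'_le: "W' t \<le> - \<eta> * W t + C' * exp (- \<beta> * t) * (1 + W t)" if t: "t \<ge> 0" for t
    proof -
      define p where "p = norm (x t)"
      define r where "r = norm (v t)"
      have pr: "p \<ge> 0" "r \<ge> 0" "n t = p\<^sup>2 + r\<^sup>2"
        by (simp_all add: p_def r_def n_def)
      have "- (x t \<bullet> v t) \<le> p * r"
        unfolding p_def r_def using Cauchy_Schwarz_ineq2 [of "x t" "v t"] by linarith
      then have "c * k * - (x t \<bullet> v t) \<le> c * k * (p * r)"
        using c assms by (intro mult_left_mono) auto
      moreover have "W' t = - k * r\<^sup>2 + c * m * r\<^sup>2 - c * a * p\<^sup>2 + c * k * - (x t \<bullet> v t) - (v t + c *\<^sub>R x t) \<bullet> X t"
        by (simp add: W'_def p_def r_def power2_norm_eq_inner inner_add_left inner_diff_right inner_commute algebra_simps)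
      moreover have "- k * r\<^sup>2 + c * m * r\<^sup>2 - c * a * p\<^sup>2 + c * k * (p * r) \<le> - (k / 2) * r\<^sup>2 - (c * a / 2) * p\<^sup>2"
        by (rule cross_term_absorption [OF \<open>a > 0\<close> c(1,2)])
      moreover have "- (k / 2) * r\<^sup>2 - (c * a / 2) * p\<^sup>2 \<le> - \<eta> * W t"
      proof -
        have "\<eta> * u \<le> k / 2" "\<eta> * u \<le> c * a / 2"
          using pos by (simp_all add: \<eta>_def)
        then have "(\<eta> * u) * r\<^sup>2 \<le> k / 2 * r\<^sup>2" "(\<eta> * u) * p\<^sup>2 \<le> c * a / 2 * p\<^sup>2"
          by (intro mult_right_mono; simp)+
        moreover have "\<eta> * W t \<le> (\<eta> * u) * p\<^sup>2 + (\<eta> * u) * r\<^sup>2"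
          using mult_left_mono [OF upper [of t], of \<eta>] pos by (simp add: pr distrib_left mult.assoc)
        ultimately show ?thesis
          by linarith
      qed
      moreover have "- ((v t + c *\<^sub>R x t) \<bullet> X t) \<le> C' * exp (- \<beta> * t) * (1 + W t)"
      proof -
        \<comment> \<open>Every monomial of degree at most 2 that occurs in the expanded product is
          dominated by \<open>1 + p\<^sup>2 + r\<^sup>2\<close>.\<close>
        have "p \<le> 1 + n t" "r \<le> 1 + n t" "p * r \<le> 1 + n t" "1 \<le> 1 + n t" "p\<^sup>2 \<le> 1 + n t" "r\<^sup>2 \<le> 1 + n t"
        proof -
          have "0 \<le> (p - 1)\<^sup>2" "0 \<le> (r - 1)\<^sup>2" "0 \<le> (p - r)\<^sup>2" "0 \<le> p\<^sup>2" "0 \<le> r\<^sup>2"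
            by simp_all
          then show "p \<le> 1 + n t" "r \<le> 1 + n t" "p * r \<le> 1 + n t" "1 \<le> 1 + n t" "p\<^sup>2 \<le> 1 + n t" "r\<^sup>2 \<le> 1 + n t"
            unfolding pr(3) by (simp_all add: power2_diff; linarith)+
        qed
        then have "B * r + a * (p * r) + k * r\<^sup>2 + c * (B * p + a * p\<^sup>2 + k * (p * r))
            \<le> B * (1 + n t) + a * (1 + n t) + k * (1 + n t) + c * (B * (1 + n t) + a * (1 + n t) + k * (1 + n t))"
          using assms c by (intro add_mono mult_left_mono add_nonneg_nonneg mult_nonneg_nonneg) auto
        then have poly: "(r + c * p) * (B + a * p + k * r) \<le> (1 + c) * (B + a + k) * (1 + n t)"
          by (simp add: power2_eq_square algebra_simps)
        have "1 + n t \<le> (1 + 1 / l) * (1 + W t)"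
        proof -
          have "n t \<le> W t / l" "0 \<le> W t"
            using lower [of t] n0 [of t] pos(1) by (auto simp: pos_le_divide_eq mult.commute intro: order_trans [rotated])
          moreover have "(1 + 1 / l) * (1 + W t) = 1 + W t + 1 / l + W t / l"
            using pos(1) by (simp add: field_simps)
          moreover have "1 / l > 0"
            using pos(1) by simp
          ultimately show ?thesis
            by linarith
        qed
        then have "(1 + c) * (B + a + k) * (1 + n t) \<le> (1 + c) * (B + a + k) * ((1 + 1 / l) * (1 + W t))"
          using assms c by (intro mult_left_mono) auto
        with poly have poly': "(r + c * p) * (B + a * p + k * r) \<le> (1 + c) * (B + a + k) * (1 + 1 / l) * (1 + W t)"
          by (simp add: mult.assoc)
        have "- ((v t + c *\<^sub>R x t) \<bullet> X t) \<le> norm (v t + c *\<^sub>R x t) * norm (X t)"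
          using Cauchy_Schwarz_ineq2 [of "v t + c *\<^sub>R x t" "X t"] by linarith
        also have "\<dots> \<le> (r + c * p) * (C * exp (- \<beta> * t) * (B + a * p + k * r))"
        proof (rule mult_mono)
          show "norm (v t + c *\<^sub>R x t) \<le> r + c * p"
            using norm_triangle_ineq [of "v t" "c *\<^sub>R x t"] c by (simp add: p_def r_def)
        qed (use X [OF t] c pr in \<open>auto simp: p_def r_def\<close>)
        also have "\<dots> = C * exp (- \<beta> * t) * ((r + c * p) * (B + a * p + k * r))"
          by (simp only: mult_ac)
        also have "\<dots> \<le> C * exp (- \<beta> * t) * ((1 + c) * (B + a + k) * (1 + 1 / l) * (1 + W t))"
          using assms poly' by (intro mult_left_mono) auto
        also have "\<dots> = C' * exp (- \<beta> * t) * (1 + W t)"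
          by (simp only: C'_def mult_ac)
        finally show ?thesis .
      qed
      ultimately show ?thesis
        by linarith
    qed
    have W0: "W t \<ge> 0" for t
      using lower [of t] n0 [of t] pos(1) by (meson mult_nonneg_nonneg less_imp_le order_trans)
    have "l * n t \<le> W t"
      by (rule lower)
    also have "W t \<le> (W 0 + 2 * C' / \<beta>) * exp (C' / \<beta>) * exp (- min \<eta> (\<beta> / 2) * t)"
      by (rule perturbed_exponential_decay [OF deriv W'_le W0 \<open>\<beta> > 0\<close> pos(4) \<open>t \<ge> 0\<close>])
    \<comment> \<open>The extra 1 keeps the final constant positive even if \<open>\<delta>\<close>
      and \<open>C\<close> are both 0.\<close>
    also have "\<dots> \<le> (2 * u * \<delta>\<^sup>2 + 2 * C' / \<beta> + 1) * exp (C' / \<beta>) * exp (- min \<eta> (\<beta> / 2) * t)"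
    proof (intro mult_right_mono)
      have "n 0 \<le> \<delta>\<^sup>2 + \<delta>\<^sup>2"
        unfolding n_def using init by (intro add_mono power_mono) auto
      then have "W 0 \<le> u * (\<delta>\<^sup>2 + \<delta>\<^sup>2)"
        by (intro order_trans [OF upper mult_left_mono]) (use pos in simp_all)
      then show "W 0 + 2 * C' / \<beta> \<le> 2 * u * \<delta>\<^sup>2 + 2 * C' / \<beta> + 1"
        by (simp add: mult.assoc)
    qed auto
    finally show ?thesis
      using pos(1) by (simp add: n_def pos_le_divide_eq mult.commute)
  qed
  show thesis
  proof (rule that [of "(2 * u * \<delta>\<^sup>2 + 2 * C' / \<beta> + 1) * exp (C' / \<beta>) / l" "min \<eta> (\<beta> / 2)"])
    show "0 < (2 * u * \<delta>\<^sup>2 + 2 * C' / \<beta> + 1) * exp (C' / \<beta>) / l"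
      using pos \<open>\<beta> > 0\<close> by (intro divide_pos_pos mult_pos_pos add_nonneg_pos add_nonneg_nonneg) auto
    show "0 < min \<eta> (\<beta> / 2)"
      using pos \<open>\<beta> > 0\<close> by simp
  qed (rule decay)
qed

section \<open>The closed loop\<close>

lemma has_vector_derivative_ddt:
  assumes "f differentiable_on {0..}" "t \<ge> 0"
  shows "(f has_vector_derivative ddt f t) (at t within {0..})"
  using assms unfolding ddt_def differentiable_on_def by (simp add: vector_derivative_works)

text \<open>A connected set with two points has no isolated points. This gives uniqueness of
  derivatives on the time axis, including the one-sided one at 0.\<close>

lemma at_within_atLeast_neq_bot:
  fixes t :: real
  assumes "t \<ge> 0"
  shows "at t within {0..} \<noteq> bot"
proof -
  have "t islimpt {0..}"
  proof (rule connected_imp_perfect)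
    fix x :: real
    have "0 \<in> {0::real..}" "1 \<in> {0::real..}"
      by auto
    then show "{0..} \<noteq> {x}"
      by (metis singletonD zero_neq_one)
  qed (use assms in auto)
  then show ?thesis
    by (simp add: trivial_limit_within)
qed

text \<open>Differentiating \<open>transpose (R t) ** R t = mat 1\<close> shows that
  \<open>transpose (R t) ** D\<close> is skew, so \<open>vee\<close> loses nothing. Applied to
  \<open>R_c\<close>, this validates the definition of \<open>Omega_c\<close>.\<close>

lemma orthogonal_matrix_derivative:
  fixes R :: "real \<Rightarrow> real^3^3"
  assumes orth: "\<And>t. t \<ge> 0 \<Longrightarrow> orthogonal_matrix (R t)"
    and R: "(R has_vector_derivative D) (at t within {0..})" and t: "t \<ge> 0"
  shows "D = R t ** hat (vee (transpose (R t) ** D))"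
proof -
  let ?S = "transpose (R t) ** D"
  have "((\<lambda>t. transpose (R t) ** R t) has_vector_derivative ?S + transpose D ** R t) (at t within {0..})"
    by (intro bounded_bilinear.has_vector_derivative [OF bounded_bilinear_matrix_matrix_mult]
        bounded_linear.has_vector_derivative [OF bounded_linear_transpose] R)
  moreover have "((\<lambda>t. transpose (R t) ** R t) has_vector_derivative 0) (at t within {0..})"
    by (rule has_vector_derivative_transform [of _ _ _ "\<lambda>_. mat 1"])
      (use t orth in \<open>auto simp: orthogonal_matrix_def\<close>)
  ultimately have "?S + transpose D ** R t = 0"
    using vector_derivative_unique_within [OF at_within_atLeast_neq_bot [OF t]] by blast
  then have "transpose ?S = - ?S"
    by (simp add: matrix_transpose_mul eq_neg_iff_add_eq_0 add.commute)
  then have "R t ** hat (vee ?S) = (R t ** transpose (R t)) ** D"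
    by (simp only: hat_vee_skew matrix_mul_assoc)
  then show ?thesis
    using orth [OF t] by (simp add: orthogonal_matrix_def)
qed

text \<open>The rows before transposition are orthonormal, and the determinant is the triple product
  of \<open>b1\<close> with \<open>(b3 x b1) x b3 = b1\<close>.\<close>

lemma rotation_matrix_frame:
  assumes "norm b1 = 1" "norm b3 = 1" "b1 \<bullet> b3 = 0"
  shows "rotation_matrix (transpose (vector [b1, cross3 b3 b1, b3]) :: real^3^3)"
proof -
  let ?M = "vector [b1, cross3 b3 b1, b3] :: real^3^3"
  have b: "b1 \<bullet> b1 = 1" "b3 \<bullet> b3 = 1" "b3 \<bullet> b1 = 0"
    using assms by (simp_all add: norm_eq_1 inner_commute)
  have c: "cross3 b3 b1 \<bullet> cross3 b3 b1 = 1"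
    using norm_cross_dot [of b3 b1] assms b by (simp flip: power2_norm_eq_inner)
  have "(?M ** transpose ?M) $ i $ j = ?M $ i \<bullet> ?M $ j" for i j
    by (simp add: matrix_matrix_mult_def transpose_def inner_vec_def)
  then have "?M ** transpose ?M = mat 1"
    using b c assms by (simp add: vec_eq_iff forall_3 mat_def dot_cross_self)
  moreover have "det ?M = 1"
  proof -
    have "cross3 (cross3 b3 b1) b3 = b1"
      using b cross_skew [of "cross3 b3 b1" b3] by (simp add: Lagrange)
    then show ?thesis
      using b by (simp flip: dot_cross_det)
  qed
  ultimately show ?thesis
    using matrix_left_right_inverse [of ?M "transpose ?M"]
    by (simp add: rotation_matrix_def orthogonal_matrix_def det_transpose)
qed

lemma rotation_matrix_transpose_mult:
  fixes P Q :: "real^'n^'n"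
  assumes "rotation_matrix P" "rotation_matrix Q"
  shows "rotation_matrix (transpose P ** Q)"
  using assms orthogonal_matrix_mul [of "transpose P" Q]
  by (simp add: rotation_matrix_def det_mul det_transpose)

lemma rotation_matrix_R_c:
  assumes "closed_loop q xd s" "t \<ge> 0"
  shows "rotation_matrix (R_c q xd s t)"
proof -
  have "command_force q xd s t \<noteq> 0" "norm (b1c s t) = 1" "b1c s t \<bullet> b3c q xd s t = 0"
    using assms by (simp_all add: closed_loop_def)
  then show ?thesis
    unfolding R_c_def by (intro rotation_matrix_frame) (simp_all add: b3c_def)
qed

section \<open>Error equations of the closed loop\<close>

definition relative_attitude :: "quadrotor \<Rightarrow> (real \<Rightarrow> real^3) \<Rightarrow> motion \<Rightarrow> real \<Rightarrow> real^3^3" where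
  "relative_attitude q xd s t = transpose (R_c q xd s t) ** att s t"

lemma transpose_relative_attitude:
  "transpose (relative_attitude q xd s t) = transpose (att s t) ** R_c q xd s t"
  by (simp add: relative_attitude_def matrix_transpose_mul)

lemma Psi_eq_attitude_potential: "Psi q xd s t = attitude_potential (relative_attitude q xd s t)"
  by (simp add: Psi_def attitude_potential_def relative_attitude_def)

lemma e_R_eq_attitude_error: "e_R q xd s t = attitude_error (relative_attitude q xd s t)"
  unfolding e_R_def attitude_error_def transpose_relative_attitude by (simp add: relative_attitude_def)

lemma e_Omega_eq:
  "e_Omega q xd s t = angvel s t - transpose (relative_attitude q xd s t) *v Omega_c q xd s t"
  unfolding e_Omega_def transpose_relative_attitude ..

lemma rotation_matrix_relative_attitude:
  assumes "closed_loop q xd s" "t \<ge> 0"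
  shows "rotation_matrix (relative_attitude q xd s t)"
  unfolding relative_attitude_def
  using assms by (intro rotation_matrix_transpose_mult rotation_matrix_R_c) (simp_all add: closed_loop_def)

text \<open>The product rule yields \<open>E hat(\<Omega>) - hat(\<Omega>_c) E\<close>. Carrying the
  second hat matrix past \<open>E\<close> turns its argument into \<open>E^T \<Omega>_c\<close>, and
  the difference of the arguments is \<open>e_Omega\<close>.\<close>

lemma relative_attitude_derivative:
  assumes cl: "closed_loop q xd s" and t: "t \<ge> 0"
  shows "(relative_attitude q xd s has_vector_derivative
      relative_attitude q xd s t ** hat (e_Omega q xd s t)) (at t within {0..})"
proof -
  let ?E = "relative_attitude q xd s t" and ?Rc = "R_c q xd s t"
    and ?w = "angvel s t" and ?wc = "Omega_c q xd s t"
  have R: "(att s has_vector_derivative att s t ** hat ?w) (at t within {0..})"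
    using has_vector_derivative_ddt [of "att s" t] cl t by (simp add: closed_loop_def)
  have Rc: "(R_c q xd s has_vector_derivative ?Rc ** hat ?wc) (at t within {0..})"
  proof -
    have *: "(R_c q xd s has_vector_derivative ddt (R_c q xd s) t) (at t within {0..})"
      using has_vector_derivative_ddt [of "R_c q xd s" t] cl t by (simp add: closed_loop_def)
    have "ddt (R_c q xd s) t = ?Rc ** hat ?wc"
      unfolding Omega_c_def
      by (rule orthogonal_matrix_derivative [OF _ * t])
        (use rotation_matrix_R_c [OF cl] in \<open>simp add: rotation_matrix_def\<close>)
    with * show ?thesis
      by simp
  qed
  have "(relative_attitude q xd s has_vector_derivative
      transpose ?Rc ** (att s t ** hat ?w) + transpose (?Rc ** hat ?wc) ** att s t) (at t within {0..})"
    unfolding relative_attitude_def [abs_def]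
    by (intro bounded_bilinear.has_vector_derivative [OF bounded_bilinear_matrix_matrix_mult]
        bounded_linear.has_vector_derivative [OF bounded_linear_transpose] R Rc)
  also have "transpose ?Rc ** (att s t ** hat ?w) + transpose (?Rc ** hat ?wc) ** att s t
      = ?E ** hat ?w - hat ?wc ** ?E"
    by (simp add: matrix_transpose_mul transpose_hat relative_attitude_def matrix_mul_assoc
        bounded_bilinear.minus_left [OF bounded_bilinear_matrix_matrix_mult])
  also have "\<dots> = ?E ** hat (e_Omega q xd s t)"
    unfolding rotation_hat [OF rotation_matrix_relative_attitude [OF cl t]] e_Omega_eq hat_diff
    by (simp add: bounded_bilinear.diff_right [OF bounded_bilinear_matrix_matrix_mult])
  finally show ?thesis .
qed

text \<open>The moment cancels the gyroscopic term and feeds forward the motion of the commanded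
  frame; only the proportional and the damping terms survive.\<close>

lemma attitude_error_motion_closed_loop:
  assumes cl: "closed_loop q xd s"
  shows "attitude_error_motion (inertia q) (kR q) (kOmega q)
    (relative_attitude q xd s) (e_Omega q xd s)"
  unfolding attitude_error_motion_def
proof (intro allI impI conjI)
  fix t :: real assume t: "t \<ge> 0"
  let ?E = "relative_attitude q xd s t" and ?w = "angvel s t" and ?wc = "Omega_c q xd s t"
    and ?J = "inertia q" and ?e = "e_Omega q xd s t"
  define y where "y = transpose ?E *v ?wc"
  show "rotation_matrix ?E"
    by (rule rotation_matrix_relative_attitude [OF cl t])
  show E: "(relative_attitude q xd s has_vector_derivative ?E ** hat ?e) (at t within {0..})"
    by (rule relative_attitude_derivative [OF cl t])
  have w: "(angvel s has_vector_derivative ddt (angvel s) t) (at t within {0..})"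
    using has_vector_derivative_ddt [of "angvel s" t] cl t by (simp add: closed_loop_def)
  have wc: "(Omega_c q xd s has_vector_derivative ddt (Omega_c q xd s) t) (at t within {0..})"
    using has_vector_derivative_ddt [of "Omega_c q xd s" t] cl t by (simp add: closed_loop_def)
  define D where "D = ddt (angvel s) t - (transpose ?E *v ddt (Omega_c q xd s) t
      + transpose (?E ** hat ?e) *v ?wc)"
  have "(e_Omega q xd s has_vector_derivative D) (at t within {0..})"
    unfolding e_Omega_eq [abs_def] D_def
    by (intro has_vector_derivative_diff bounded_bilinear.has_vector_derivative [OF bounded_bilinear_matrix_vector_mult]
        bounded_linear.has_vector_derivative [OF bounded_linear_transpose] E [unfolded e_Omega_eq] w wc)
  moreover have "?J *v D = - kR q *\<^sub>R attitude_error ?E - kOmega q *\<^sub>R ?e"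
  proof -
    have "transpose (?E ** hat ?e) *v ?wc = - (hat ?e *v y)"
      unfolding y_def
      by (simp only: matrix_transpose_mul transpose_hat matrix_vector_mul_assoc
          bounded_bilinear.minus_left [OF bounded_bilinear_matrix_matrix_mult]
          bounded_bilinear.minus_left [OF bounded_bilinear_matrix_vector_mult])
    \<comment> \<open>\<open>e_Omega\<close> is the angular velocity minus \<open>y\<close>, and the
      cross product of \<open>y\<close> with itself vanishes.\<close>
    also have "hat ?e *v y = cross3 ?w y"
      unfolding hat_mult_vector e_Omega_eq y_def [symmetric] by (simp add: Cross3.left_diff_distrib)
    finally have D: "D = ddt (angvel s) t - transpose ?E *v ddt (Omega_c q xd s) t + cross3 ?w y"
      by (simp add: D_def)
    have "(hat ?w ** transpose (att s t) ** R_c q xd s t) *v ?wc = cross3 ?w y"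
      unfolding y_def transpose_relative_attitude hat_mult_vector [symmetric]
      by (simp only: matrix_vector_mul_assoc matrix_mul_assoc)
    then have "?J *v ddt (angvel s) t + cross3 ?w (?J *v ?w) =
        - kR q *\<^sub>R attitude_error ?E - kOmega q *\<^sub>R ?e + cross3 ?w (?J *v ?w)
        - ?J *v (cross3 ?w y - transpose ?E *v ddt (Omega_c q xd s) t)"
      using cl t by (simp add: closed_loop_def moment_def e_R_eq_attitude_error transpose_relative_attitude)
    then show ?thesis
      unfolding D matrix_vector_right_distrib matrix_vector_mult_diff_distrib
      by (simp add: algebra_simps)
  qed
  ultimately show "\<exists>D. (e_Omega q xd s has_vector_derivative D) (at t within {0..}) \<and>
      ?J *v D = - kR q *\<^sub>R attitude_error ?E - kOmega q *\<^sub>R ?e"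
    by blast
qed

text \<open>The force that acts on the quadrotor is \<open>- f R e3\<close>, while \<open>command_force\<close> is the one that
  would make the position error a damped oscillator.\<close>

definition thrust_mismatch :: "quadrotor \<Rightarrow> (real \<Rightarrow> real^3) \<Rightarrow> motion \<Rightarrow> real \<Rightarrow> real^3" where
  "thrust_mismatch q xd s t = command_force q xd s t + thrust q xd s t *\<^sub>R (att s t *v e3)"

lemma position_error_derivative:
  assumes cl: "closed_loop q xd s" and "smooth_signal xd" and t: "t \<ge> 0"
  shows "(e_x xd s has_vector_derivative e_v xd s t) (at t within {0..})"
proof -
  have "(ddt ^^ 0) xd differentiable_on {0..}"
    using assms unfolding smooth_signal_def by blast
  then show ?thesis
    using has_vector_derivative_diff [OF has_vector_derivative_ddt has_vector_derivative_ddt, of "pos s" t xd] cl t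
    by (simp add: closed_loop_def e_x_def [abs_def] e_v_def)
qed

lemma velocity_error_derivative:
  assumes cl: "closed_loop q xd s" and "smooth_signal xd" and t: "t \<ge> 0" and m: "mass q > 0"
  shows "(e_v xd s has_vector_derivative
      (- kx q *\<^sub>R e_x xd s t - kv q *\<^sub>R e_v xd s t - thrust_mismatch q xd s t) /\<^sub>R mass q)
    (at t within {0..})"
proof -
  have "(ddt ^^ 1) xd differentiable_on {0..}"
    using assms unfolding smooth_signal_def by blast
  then have "(e_v xd s has_vector_derivative ddt (vel s) t - ddt (ddt xd) t) (at t within {0..})"
    unfolding e_v_def [abs_def] using cl t
    by (intro has_vector_derivative_diff has_vector_derivative_ddt) (simp_all add: closed_loop_def)
  moreover have "mass q *\<^sub>R (ddt (vel s) t - ddt (ddt xd) t)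
      = - kx q *\<^sub>R e_x xd s t - kv q *\<^sub>R e_v xd s t - thrust_mismatch q xd s t"
    using cl t by (simp add: closed_loop_def thrust_mismatch_def command_force_def scaleR_diff_right)
  then have "ddt (vel s) t - ddt (ddt xd) t
      = (- kx q *\<^sub>R e_x xd s t - kv q *\<^sub>R e_v xd s t - thrust_mismatch q xd s t) /\<^sub>R mass q"
    using m by (metis less_irrefl scaleR_left_imp_eq scaleR_scaleR right_inverse scaleR_one)
  ultimately show ?thesis
    by simp
qed

text \<open>The thrust is minus the component of the commanded force along \<open>R e3\<close>, so
  the mismatch is the part of that force orthogonal to \<open>R e3\<close>. Its length is the force
  times the sine of the angle between \<open>b3c\<close> and \<open>R e3\<close>, whose cosine is
  \<open>E$3$3\<close>.\<close>

lemma norm_thrust_mismatch_le: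
  assumes cl: "closed_loop q xd s" and t: "t \<ge> 0"
  shows "norm (thrust_mismatch q xd s t)
    \<le> norm (command_force q xd s t) * (2 * sqrt (Psi q xd s t))"
proof -
  let ?A = "command_force q xd s t" and ?r = "att s t *v e3" and ?E = "relative_attitude q xd s t"
  have rot: "rotation_matrix ?E"
    by (rule rotation_matrix_relative_attitude [OF cl t])
  have A: "?A \<noteq> 0"
    using cl t by (simp add: closed_loop_def)
  have "norm ?r = 1"
    using norm_orthogonal_matrix_mult [of "att s t" e3] cl t
    by (simp add: closed_loop_def rotation_matrix_def)
  then have r: "?r \<bullet> ?r = 1"
    by (simp add: norm_eq_1)
  have "thrust q xd s t = - (?A \<bullet> ?r)"
    unfolding thrust_def inner_minus_left [symmetric] by (simp add: command_force_def algebra_simps)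
  then have X: "thrust_mismatch q xd s t = ?A - (?A \<bullet> ?r) *\<^sub>R ?r"
    by (simp add: thrust_mismatch_def)
  have "?A = - norm ?A *\<^sub>R b3c q xd s t"
    using A by (simp add: b3c_def)
  then have Ar: "?A \<bullet> ?r = - norm ?A * (b3c q xd s t \<bullet> ?r)"
    by (metis inner_scaleR_left)
  have E33: "b3c q xd s t \<bullet> ?r = ?E $ 3 $ 3"
    by (simp add: relative_attitude_def R_c_def transpose_transpose matrix_matrix_mult_def
        matrix_vector_mult_basis column_def inner_vec_def)
  have "(norm (thrust_mismatch q xd s t))\<^sup>2 = (norm ?A)\<^sup>2 - (?A \<bullet> ?r)\<^sup>2"
    unfolding X power2_norm_eq_inner using r
    by (simp add: inner_diff_left inner_diff_right inner_commute power2_eq_square)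
  also have "\<dots> = (norm ?A)\<^sup>2 * (1 - (?E $ 3 $ 3)\<^sup>2)"
    unfolding Ar E33 by (simp add: power_mult_distrib right_diff_distrib)
  also have "\<dots> \<le> (norm ?A)\<^sup>2 * (4 * Psi q xd s t)"
    unfolding Psi_eq_attitude_potential
    by (intro mult_left_mono one_minus_E33_sq_le rot) simp
  also have "\<dots> = (norm ?A * (2 * sqrt (Psi q xd s t)))\<^sup>2"
    using attitude_potential_nonneg [OF rot] by (simp add: power_mult_distrib Psi_eq_attitude_potential)
  finally show ?thesis
    by (rule power2_le_imp_le)
      (use attitude_potential_nonneg [OF rot] in \<open>simp add: Psi_eq_attitude_potential\<close>)
qed

section \<open>Uniform constants and the combined estimate\<close>

text \<open>On \<open>K\<close> the energy is pointwise below \<open>2 * a\<close>; compactness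
  turns this into one bound with a gap, common to all initial data.\<close>

lemma ex_uniform_initial_energy_bound:
  fixes K :: "(real \<times> (real^3)) set"
  assumes J: "positive_definite J" and "a > 0" and "compact K"
    and K: "\<And>\<psi> \<omega>. (\<psi>, \<omega>) \<in> K \<Longrightarrow> (norm \<omega>)\<^sup>2 < 2 / max_eigenvalue J * a * (2 - \<psi>)"
  obtains \<psi> where "\<psi> < 2"
    "\<And>E w. (attitude_potential E, w) \<in> K \<Longrightarrow> attitude_energy J a E w \<le> a * \<psi>"
proof (cases "K = {}")
  case True
  show thesis
    by (rule that [of 0]) (simp_all add: True)
next
  case False
  define \<Lambda> where "\<Lambda> = max_eigenvalue J"
  \<comment> \<open>Replaces the kinetic form by its eigenvalue bound, so that the majorant is a
    continuous function of the pair in \<open>K\<close> alone.\<close>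
  define g where "g = (\<lambda>(p :: real, \<omega> :: real^3). \<Lambda> / 2 * (norm \<omega>)\<^sup>2 + a * p)"
  have form_le: "v \<bullet> (J *v v) \<le> \<Lambda> * (norm v)\<^sup>2" for v
    unfolding \<Lambda>_def using J by (intro quadratic_form_le_max_eigenvalue) (simp add: positive_definite_def)
  have "0 < e3 \<bullet> (J *v e3)"
    using J by (simp add: positive_definite_def axis_eq_0_iff)
  with form_le [of e3] have "\<Lambda> > 0"
    by simp
  have "continuous_on K g"
    unfolding g_def case_prod_beta by (intro continuous_intros)
  then obtain z where z: "z \<in> K" "\<And>y. y \<in> K \<Longrightarrow> g y \<le> g z"
    using continuous_attains_sup [OF \<open>compact K\<close> False] by blast
  show thesis
  proof (rule that [of "g z / a"])
    obtain p \<omega> where p: "z = (p, \<omega>)"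
      by (cases z)
    have "\<Lambda> / 2 * (norm \<omega>)\<^sup>2 < \<Lambda> / 2 * (2 / \<Lambda> * a * (2 - p))"
      using K [of p \<omega>] z(1) \<open>\<Lambda> > 0\<close> by (intro mult_strict_left_mono) (simp_all add: p \<Lambda>_def)
    also have "\<dots> = a * (2 - p)"
      using \<open>\<Lambda> > 0\<close> by simp
    finally have "g z < 2 * a"
      by (simp add: g_def p algebra_simps)
    then show "g z / a < 2"
      using \<open>a > 0\<close> by (simp add: pos_divide_less_eq)
    fix E w assume *: "(attitude_potential E, w) \<in> K"
    have "attitude_energy J a E w \<le> g (attitude_potential E, w)"
      using form_le [of w] by (simp add: attitude_energy_def g_def)
    with z(2) [OF *] \<open>a > 0\<close> show "attitude_energy J a E w \<le> a * (g z / a)"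
      by simp
  qed
qed

lemma norm_tracking_error_sq:
  "(norm (tracking_error q xd s t))\<^sup>2 = (norm (e_x xd s t))\<^sup>2 + (norm (e_v xd s t))\<^sup>2
     + (norm (e_R q xd s t))\<^sup>2 + (norm (e_Omega q xd s t))\<^sup>2"
  by (simp add: tracking_error_def norm_Pair)

lemma norm_command_force_le:
  assumes "admissible_quadrotor q"
    and "norm (- (mass q * grav q) *\<^sub>R e3 + mass q *\<^sub>R ddt (ddt xd) t) < B"
  shows "norm (command_force q xd s t) \<le> B + kx q * norm (e_x xd s t) + kv q * norm (e_v xd s t)"
proof -
  let ?b = "- (mass q * grav q) *\<^sub>R e3 + mass q *\<^sub>R ddt (ddt xd) t"
  have "command_force q xd s t = ?b - (kx q *\<^sub>R e_x xd s t + kv q *\<^sub>R e_v xd s t)"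
    by (simp add: command_force_def)
  then have "norm (command_force q xd s t)
      \<le> norm ?b + (norm (kx q *\<^sub>R e_x xd s t) + norm (kv q *\<^sub>R e_v xd s t))"
    by (simp only: order_trans [OF norm_triangle_ineq4 add_left_mono [OF norm_triangle_ineq]])
  then show ?thesis
    using assms by (simp add: admissible_quadrotor_def)
qed

text \<open>The admissible initial data form a region that is open towards its energy threshold,
  where the gap behind the constants shrinks to 0. A compact \<open>K\<close> inside it permits
  constants shared by all trajectories; a singleton \<open>K\<close> covers any single admissible
  initial condition.\<close>

theorem proposition4:
  fixes q :: quadrotor and xd :: "real \<Rightarrow> real^3" and B :: real
    and K :: "(real \<times> (real^3)) set"
  assumes "admissible_quadrotor q"
    and "smooth_signal xd"
    and "B > 0"
    and "\<And>t. t \<ge> 0 \<Longrightarrow>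
           norm (- (mass q * grav q) *\<^sub>R e3 + mass q *\<^sub>R ddt (ddt xd) t) < B"
    and "compact K"
    and "\<And>\<psi> \<omega>. (\<psi>, \<omega>) \<in> K \<Longrightarrow>
           1 \<le> \<psi> \<and> \<psi> < 2 \<and>
           (norm \<omega>)\<^sup>2 < 2 / max_eigenvalue (inertia q) * kR q * (2 - \<psi>)"
  shows "\<forall>\<delta>>0. exponentially_attractive \<delta>
           {tracking_error q xd s | s.
              closed_loop q xd s \<and> (Psi q xd s 0, e_Omega q xd s 0) \<in> K}"
proof (intro allI impI)
  fix \<delta> :: real assume "\<delta> > 0"
  have q: "mass q > 0" "positive_definite (inertia q)" "kx q > 0" "kv q > 0" "kR q > 0" "kOmega q > 0"
    using assms(1) by (simp_all add: admissible_quadrotor_def)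
  obtain \<psi> where \<psi>: "\<psi> < 2" "\<And>E w. (attitude_potential E, w) \<in> K \<Longrightarrow>
      attitude_energy (inertia q) (kR q) E w \<le> kR q * \<psi>"
    by (rule ex_uniform_initial_energy_bound [OF q(2,5) assms(5)]) (use assms(6) in blast)+
  obtain \<alpha>1 \<beta> where att: "\<alpha>1 > 0" "\<beta> > 0"
    "\<And>E w t. \<lbrakk>attitude_error_motion (inertia q) (kR q) (kOmega q) E w;
        attitude_energy (inertia q) (kR q) (E 0) (w 0) \<le> kR q * \<psi>; t \<ge> 0\<rbrakk>
       \<Longrightarrow> attitude_potential (E t) + (norm (w t))\<^sup>2 \<le> \<alpha>1 * exp (- \<beta> * t)"
    by (rule attitude_error_decay [OF q(2,5,6) \<psi>(1)]) blast
  \<comment> \<open>The attitude estimate feeds the translation: the mismatch is of order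
    \<open>sqrt Psi\<close>, hence the constant \<open>2 * sqrt \<alpha>1\<close> and the halved
    rate.\<close>
  obtain \<alpha>2 \<gamma> where trans: "\<alpha>2 > 0" "\<gamma> > 0"
    "\<And>(x :: real \<Rightarrow> real^3) v X t.
       \<lbrakk>\<And>t. t \<ge> 0 \<Longrightarrow> (x has_vector_derivative v t) (at t within {0..});
        \<And>t. t \<ge> 0 \<Longrightarrow> (v has_vector_derivative (- kx q *\<^sub>R x t - kv q *\<^sub>R v t - X t) /\<^sub>R mass q) (at t within {0..});
        \<And>t. t \<ge> 0 \<Longrightarrow> norm (X t) \<le> 2 * sqrt \<alpha>1 * exp (- (\<beta> / 2) * t) * (B + kx q * norm (x t) + kv q * norm (v t));
        norm (x 0) \<le> \<delta>; norm (v 0) \<le> \<delta>; t \<ge> 0\<rbrakk>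
       \<Longrightarrow> (norm (x t))\<^sup>2 + (norm (v t))\<^sup>2 \<le> \<alpha>2 * exp (- \<gamma> * t)"
    by (rule perturbed_translation_decay [of "mass q" "kx q" "kv q" B "2 * sqrt \<alpha>1" "\<beta> / 2" \<delta>])
      (use q \<open>B > 0\<close> \<open>\<delta> > 0\<close> att(1,2) in auto)
  \<comment> \<open>The slower of the two rates of the squared errors; the square root halves it at
    the end.\<close>
  define \<kappa> where "\<kappa> = min \<beta> \<gamma>"
  have decay: "norm (tracking_error q xd s t) \<le> sqrt (\<alpha>2 + 2 * \<alpha>1) * exp (- (\<kappa> / 2) * t)"
    if cl: "closed_loop q xd s" and init: "(Psi q xd s 0, e_Omega q xd s 0) \<in> K"
      and small: "norm (tracking_error q xd s 0) < \<delta>" and t: "t > 0" for s t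
  proof -
    let ?E = "relative_attitude q xd s"
    have rot: "rotation_matrix (?E t)" if "t \<ge> 0" for t
      by (rule rotation_matrix_relative_attitude [OF cl that])
    have potential: "Psi q xd s t + (norm (e_Omega q xd s t))\<^sup>2 \<le> \<alpha>1 * exp (- \<beta> * t)" if "t \<ge> 0" for t
      unfolding Psi_eq_attitude_potential
      by (rule att(3) [OF attitude_error_motion_closed_loop [OF cl] \<psi>(2) that])
        (use init in \<open>simp add: Psi_eq_attitude_potential\<close>)
    have mismatch: "norm (thrust_mismatch q xd s t) \<le> 2 * sqrt \<alpha>1 * exp (- (\<beta> / 2) * t)
        * (B + kx q * norm (e_x xd s t) + kv q * norm (e_v xd s t))" if t: "t \<ge> 0" for t
    proof -
      have "Psi q xd s t \<le> \<alpha>1 * exp (- \<beta> * t)"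
        using potential [OF t] by (smt (verit) zero_le_power2)
      also have "\<dots> = (sqrt \<alpha>1 * exp (- (\<beta> / 2) * t))\<^sup>2"
        using att(1) by (simp add: power_mult_distrib flip: exp_double)
      finally have "sqrt (Psi q xd s t) \<le> sqrt \<alpha>1 * exp (- (\<beta> / 2) * t)"
        using att(1) by (intro real_le_lsqrt) (auto simp: attitude_potential_nonneg rot t Psi_eq_attitude_potential)
      then have "norm (command_force q xd s t) * (2 * sqrt (Psi q xd s t))
          \<le> (B + kx q * norm (e_x xd s t) + kv q * norm (e_v xd s t)) * (2 * (sqrt \<alpha>1 * exp (- (\<beta> / 2) * t)))"
        using q \<open>B > 0\<close> attitude_potential_nonneg [OF rot [OF t]]
        by (intro mult_mono norm_command_force_le assms t) (auto simp: Psi_eq_attitude_potential)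
      with norm_thrust_mismatch_le [OF cl t] show ?thesis
        by (simp add: mult_ac)
    qed
    have "(norm (e_x xd s 0))\<^sup>2 \<le> \<delta>\<^sup>2" "(norm (e_v xd s 0))\<^sup>2 \<le> \<delta>\<^sup>2"
    proof -
      have "(norm (tracking_error q xd s 0))\<^sup>2 \<le> \<delta>\<^sup>2"
        using small by (intro power_mono) auto
      then show "(norm (e_x xd s 0))\<^sup>2 \<le> \<delta>\<^sup>2" "(norm (e_v xd s 0))\<^sup>2 \<le> \<delta>\<^sup>2"
        unfolding norm_tracking_error_sq by (smt (verit) zero_le_power2)+
    qed
    then have init': "norm (e_x xd s 0) \<le> \<delta>" "norm (e_v xd s 0) \<le> \<delta>"
      using \<open>\<delta> > 0\<close> by (auto intro: power2_le_imp_le)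
    have t0: "t \<ge> 0"
      using t by simp
    have position: "(norm (e_x xd s t))\<^sup>2 + (norm (e_v xd s t))\<^sup>2 \<le> \<alpha>2 * exp (- \<gamma> * t)"
      by (rule trans(3) [OF position_error_derivative [OF cl assms(2)]
          velocity_error_derivative [OF cl assms(2) _ q(1)] mismatch init' t0])
    have "(norm (e_R q xd s t))\<^sup>2 \<le> 2 * Psi q xd s t"
      unfolding e_R_eq_attitude_error Psi_eq_attitude_potential
      by (rule norm_attitude_error_sq_le [OF rot [OF t0]])
    then have "(norm (tracking_error q xd s t))\<^sup>2 \<le> \<alpha>2 * exp (- \<gamma> * t) + 2 * (\<alpha>1 * exp (- \<beta> * t))"
      using position potential [OF t0] zero_le_power2 [of "norm (e_Omega q xd s t)"]
      unfolding norm_tracking_error_sq by linarith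
    also have "\<dots> \<le> \<alpha>2 * exp (- \<kappa> * t) + 2 * (\<alpha>1 * exp (- \<kappa> * t))"
      using att(1) trans(1) t by (intro add_mono mult_left_mono) (auto simp: \<kappa>_def intro!: mult_right_mono)
    also have "\<dots> = (sqrt (\<alpha>2 + 2 * \<alpha>1) * exp (- (\<kappa> / 2) * t))\<^sup>2"
      using att(1) trans(1) by (simp add: power_mult_distrib distrib_right flip: exp_double)
    finally show ?thesis
      by (rule power2_le_imp_le) (use att(1) trans(1) in simp)
  qed
  show "exponentially_attractive \<delta>
      {tracking_error q xd s | s. closed_loop q xd s \<and> (Psi q xd s 0, e_Omega q xd s 0) \<in> K}"
    unfolding exponentially_attractive_def
  proof (intro exI conjI)
    show "sqrt (\<alpha>2 + 2 * \<alpha>1) > 0" "\<kappa> / 2 > 0"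
      using att(1,2) trans(1,2) by (simp_all add: \<kappa>_def)
    show "\<forall>z\<in>{tracking_error q xd s | s. closed_loop q xd s \<and> (Psi q xd s 0, e_Omega q xd s 0) \<in> K}.
        norm (z 0) < \<delta> \<longrightarrow> (\<forall>t>0. norm (z t) \<le> sqrt (\<alpha>2 + 2 * \<alpha>1) * exp (- (\<kappa> / 2) * t))"
      using decay by blast
  qed
qed

end
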